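(* Let $F(z)=\sum_{n=0}^\infty c_nz^n$ be analytic in the unit disc $\mathbb{D}$. Suppose there is a closed subset $E\subset\partial\mathbb{D}$ of linear measure zero such that $F$ has local pseudofunction boundary behavior on $\partial\mathbb{D}\setminus E$, while for each $e^{i\theta}\in E$ one has $\sum_{n=0}^Nc_ne^{in\theta}=O_\theta(1)$ as $N\to\infty$. Then $F$ has pseudofunction boundary behavior on the whole of $\partial\mathbb{D}$, that is, $c_n=o(1)$. In particular, $\sum_{n=0}^\infty c_ne^{in\theta_0}$ converges at every point $e^{i\theta_0}\in\partial\mathbb{D}$ for which there is a constant $F(e^{i\theta_0})$ such that $\frac{F(z)-F(e^{i\theta_0})}{z-e^{i\theta_0}}$ has pseudofunction boundary behavior at $z=e^{i\theta_0}$, and then $\sum_{n=0}^\infty c_ne^{in\theta_0}=F(e^{i\theta_0})$.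
   Context: Fourier transform $\hat\varphi(t)=\int e^{-itx}\varphi(x)\,\mathrm{d}x$. A tempered distribution $g$ is a pseudofunction if $\hat g\in L^\infty$ and $\hat g(x)\to0$ as $|x|\to\infty$; a distribution on an open $U\subseteq\mathbb{R}$ is a local pseudofunction on $U$ if near each point of $U$ it coincides with a pseudofunction. An analytic $H$ on $\mathbb{D}$ has local pseudofunction boundary behavior on an open arc $\{e^{i\theta}:\theta\in U\}$ ($U\subseteq\mathbb{R}$ open) if $H(re^{i\theta})$ converges in $\mathcal{D}'(U)$ as $r\to1^-$ to a local pseudofunction on $U$; at a point $e^{i\theta_0}$ if this holds for some open $U\ni\theta_0$; on all of $\partial\mathbb{D}$ if it holds with $U=\mathbb{R}$ (the limit being a $2\pi$-periodic distribution). *)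

theory Defs
  imports "HOL-Analysis.Analysis"
begin

definition smooth_fun :: "(real \<Rightarrow> complex) \<Rightarrow> bool" where
  "smooth_fun \<phi> \<longleftrightarrow>
     (\<exists>D :: nat \<Rightarrow> real \<Rightarrow> complex. D 0 = \<phi> \<and>
        (\<forall>n x. (D n has_vector_derivative D (Suc n) x) (at x)))"

definition test_fun :: "real set \<Rightarrow> (real \<Rightarrow> complex) \<Rightarrow> bool" where
  "test_fun U \<phi> \<longleftrightarrow> smooth_fun \<phi> \<and> compact (closure {x. \<phi> x \<noteq> 0})
      \<and> closure {x. \<phi> x \<noteq> 0} \<subseteq> U"

definition fourier :: "(real \<Rightarrow> complex) \<Rightarrow> real \<Rightarrow> complex" where
  "fourier \<phi> t = (LINT x|lborel. cis (- (t * x)) * \<phi> x)"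

text \<open>The functional T coincides on the open set V with a pseudofunction g,
  i.e. with the tempered distribution g whose Fourier transform is a bounded
  measurable function psi tending to 0 at infinity; then
  g(phi) = (1/(2 pi)) int psi(t) hat phi(-t) dt.\<close>
definition pseudofun_on :: "real set \<Rightarrow> ((real \<Rightarrow> complex) \<Rightarrow> complex) \<Rightarrow> bool" where
  "pseudofun_on V T \<longleftrightarrow>
     (\<exists>\<psi> :: real \<Rightarrow> complex. \<psi> \<in> borel_measurable borel \<and> bounded (range \<psi>) \<and>
        (\<psi> \<longlongrightarrow> 0) at_infinity \<and>
        (\<forall>\<phi>. test_fun V \<phi> \<longrightarrow>
           T \<phi> = (LINT t|lborel. \<psi> t * fourier \<phi> (- t)) / complex_of_real (2 * pi)))"

definition local_pseudofun :: "real set \<Rightarrow> ((real \<Rightarrow> complex) \<Rightarrow> complex) \<Rightarrow> bool" where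
  "local_pseudofun U T \<longleftrightarrow>
     (\<forall>x\<in>U. \<exists>V. open V \<and> x \<in> V \<and> V \<subseteq> U \<and> pseudofun_on V T)"

text \<open>Local pseudofunction boundary behaviour of H on the arc {e^{i theta}: theta in U}:
  H(r e^{i theta}) converges in D'(U) as r -> 1- to a local pseudofunction on U.\<close>
definition lpf_boundary :: "(complex \<Rightarrow> complex) \<Rightarrow> real set \<Rightarrow> bool" where
  "lpf_boundary H U \<longleftrightarrow>
     (\<exists>T. (\<forall>\<phi>. test_fun U \<phi> \<longrightarrow>
            ((\<lambda>r. LINT \<theta>|lborel. H (complex_of_real r * cis \<theta>) * \<phi> \<theta>) \<longlongrightarrow> T \<phi>)
              (at_left 1))
         \<and> local_pseudofun U T)"

definition lpf_boundary_at :: "(complex \<Rightarrow> complex) \<Rightarrow> real \<Rightarrow> bool" where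
  "lpf_boundary_at H \<theta>0 \<longleftrightarrow> (\<exists>U. open U \<and> \<theta>0 \<in> U \<and> lpf_boundary H U)"

end

theory Submission
  imports Defs "HOL-Probability.Sinc_Integral"
begin

text \<open>Tested against a smooth \<open>\<phi>\<close> of compact support, the boundary distribution of \<open>F\<close> is
  \<open>\<phi> \<mapsto> \<Sum>k. c k * fourier \<phi> (- k)\<close>; call \<open>\<phi>\<close> null if the values at the modulated functions
  \<open>\<phi> e\<^sup>-\<^sup>i\<^sup>n\<^sup>\<theta>\<close> tend to 0 as \<open>n\<close> grows. Test functions supported off \<open>E\<close> are null, and a partition
  of unity on the circle shows that \<open>c\<close> tends to 0 once all test functions are null.
  Let \<open>B \<subseteq> E\<close> be the closed set of points without a neighbourhood on which all test functions
  are null. If \<open>B\<close> is nonempty, Baire's theorem gives a relatively open nonempty part of it on which the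
  partial sums of the series are bounded by a single \<open>M\<close>. Split a test function supported near this part into
  pieces of width \<open>\<delta>\<close>. The pieces whose support avoids \<open>B\<close> are null. A piece meeting \<open>B\<close> at \<open>\<theta>\<close>
  contributes \<open>O(M \<delta>)\<close>, uniformly in \<open>n\<close>, through summation by parts against the partial sums at \<open>\<theta>\<close>,
  and the number of such pieces is \<open>o(1/\<delta>)\<close> because \<open>B\<close> is compact there and has measure zero. So the
  test function is null, which contradicts the choice of \<open>B\<close>.
  For convergence at \<open>e\<^sup>i\<^sup>\<theta>\<close>, the coefficients of \<open>(F z - L) / (z - e\<^sup>i\<^sup>\<theta>)\<close> are, up to unimodular factors,
  the differences between \<open>L\<close> and the partial sums, and all test functions are null for this quotient too.\<close>

section \<open>Smooth functions and smooth partitions of unity\<close>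

primrec diff_times :: "nat \<Rightarrow> (real \<Rightarrow> complex) \<Rightarrow> bool" where
  "diff_times 0 f = True"
| "diff_times (Suc n) f =
     (\<exists>f'. (\<forall>x. (f has_vector_derivative f' x) (at x)) \<and> diff_times n f')"

lemma smooth_fun_derivE:
  assumes "smooth_fun f"
  obtains f' where "smooth_fun f'" "\<And>x. (f has_vector_derivative f' x) (at x)"
proof -
  obtain D where D: "D 0 = f" "\<And>n x. (D n has_vector_derivative D (Suc n) x) (at x)"
    using assms unfolding smooth_fun_def by blast
  have "smooth_fun (D 1)"
    unfolding smooth_fun_def by (rule exI[of _ "\<lambda>n. D (Suc n)"]) (use D in auto)
  moreover have "(f has_vector_derivative D 1 x) (at x)" for x
    using D(2)[of 0 x] D(1) by simp
  ultimately show ?thesis using that by blast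
qed

text \<open>Replaces the full sequence of derivatives by finite orders, where sums and products go
  by induction. Conversely the witnesses of different orders must fit together; iterating
  \<open>vector_derivative\<close> achieves this because derivatives are unique.\<close>

lemma smooth_fun_iff_diff_times: "smooth_fun f \<longleftrightarrow> (\<forall>n. diff_times n f)"
proof
  assume "smooth_fun f"
  moreover have "smooth_fun g \<Longrightarrow> diff_times n g" for n g
  proof (induction n arbitrary: g)
    case (Suc n)
    then show ?case by (metis diff_times.simps(2) smooth_fun_derivE)
  qed simp
  ultimately show "\<forall>n. diff_times n f" by blast
next
  assume f: "\<forall>n. diff_times n f"
  define D where "D n = ((\<lambda>f x. vector_derivative f (at x)) ^^ n) f" for n
  have step: "\<forall>x. (g has_vector_derivative vector_derivative g (at x)) (at x) \<and>
      diff_times m (\<lambda>x. vector_derivative g (at x))" if g: "diff_times (Suc m) g" for g m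
  proof -
    obtain g' where g': "\<forall>x. (g has_vector_derivative g' x) (at x)" "diff_times m g'"
      using g by auto
    then have "(\<lambda>x. vector_derivative g (at x)) = g'"
      by (auto simp: vector_derivative_at)
    then show ?thesis using g' by (metis vector_derivative_at)
  qed
  have all: "\<forall>m. diff_times m (D n)" for n
  proof (induction n)
    case (Suc n)
    have "diff_times m (D (Suc n))" for m
      using step[of m "D n"] Suc.IH[rule_format, of "Suc m"] by (simp add: D_def)
    then show ?case by blast
  qed (simp add: D_def f)
  have "(D n has_vector_derivative D (Suc n) x) (at x)" for n x
    using step[of 0 "D n"] all[of n, rule_format, of "Suc 0"] by (simp add: D_def)
  then show "smooth_fun f"
    unfolding smooth_fun_def by (intro exI[of _ D]) (simp add: D_def)
qed

text \<open>Allows smoothness to be shown by naming a family that differentiation does not leave,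
  without formulas for the higher derivatives.\<close>

lemma smooth_fun_coinduct:
  assumes "f \<in> S"
    and "\<And>g. g \<in> S \<Longrightarrow> \<exists>g'\<in>S. \<forall>x. (g has_vector_derivative g' x) (at x)"
  shows "smooth_fun f"
proof -
  have "\<forall>g\<in>S. diff_times n g" for n
  proof (induction n)
    case (Suc n)
    then show ?case using assms(2) by (metis diff_times.simps(2))
  qed simp
  then show ?thesis using assms(1) smooth_fun_iff_diff_times by blast
qed

lemma diff_times_Suc: "diff_times (Suc n) f \<Longrightarrow> diff_times n f"
  by (induction n arbitrary: f) auto

lemma diff_times_add: "diff_times n f \<Longrightarrow> diff_times n g \<Longrightarrow> diff_times n (\<lambda>x. f x + g x)"
proof (induction n arbitrary: f g)
  case (Suc n)
  obtain f' where f': "\<forall>x. (f has_vector_derivative f' x) (at x)" "diff_times n f'"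
    using Suc.prems(1) by auto
  obtain g' where g': "\<forall>x. (g has_vector_derivative g' x) (at x)" "diff_times n g'"
    using Suc.prems(2) by auto
  show ?case unfolding diff_times.simps
    by (rule exI[of _ "\<lambda>x. f' x + g' x"])
      (use f' g' Suc.IH in \<open>auto intro!: has_vector_derivative_add\<close>)
qed simp

lemma diff_times_mult: "diff_times n f \<Longrightarrow> diff_times n g \<Longrightarrow> diff_times n (\<lambda>x. f x * g x)"
proof (induction n arbitrary: f g)
  case (Suc n)
  obtain f' where f': "\<forall>x. (f has_vector_derivative f' x) (at x)" "diff_times n f'"
    using Suc.prems(1) by auto
  obtain g' where g': "\<forall>x. (g has_vector_derivative g' x) (at x)" "diff_times n g'"
    using Suc.prems(2) by auto
  have "diff_times n f" "diff_times n g" using Suc.prems diff_times_Suc by blast+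
  then show ?case unfolding diff_times.simps
    by (intro exI[of _ "\<lambda>x. f x * g' x + f' x * g x"] conjI allI has_vector_derivative_mult
        diff_times_add Suc.IH) (use f' g' in auto)
qed simp

lemma smooth_fun_add: "smooth_fun f \<Longrightarrow> smooth_fun g \<Longrightarrow> smooth_fun (\<lambda>x. f x + g x)"
  by (simp add: smooth_fun_iff_diff_times diff_times_add)

lemma smooth_fun_mult: "smooth_fun f \<Longrightarrow> smooth_fun g \<Longrightarrow> smooth_fun (\<lambda>x. f x * g x)"
  by (simp add: smooth_fun_iff_diff_times diff_times_mult)

lemma smooth_fun_const: "smooth_fun (\<lambda>x. a)"
  by (rule smooth_fun_coinduct[of _ "range (\<lambda>a x. a)"]) (auto intro!: exI[of _ 0])

lemma smooth_fun_cmult: "smooth_fun f \<Longrightarrow> smooth_fun (\<lambda>x. a * f x)"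
  by (intro smooth_fun_mult smooth_fun_const)

lemma smooth_fun_diff: "smooth_fun f \<Longrightarrow> smooth_fun g \<Longrightarrow> smooth_fun (\<lambda>x. f x - g x)"
  using smooth_fun_add[of f "\<lambda>x. (-1) * g x"] smooth_fun_cmult[of g "-1"] by simp

lemma has_vector_derivative_cis:
  "((\<lambda>x. cis (a * x)) has_vector_derivative (\<i> * complex_of_real a * cis (a * x))) (at x)"
proof -
  have "((\<lambda>x. exp (\<i> * complex_of_real a * of_real x)) has_vector_derivative
      (\<i> * complex_of_real a * exp (\<i> * complex_of_real a * of_real x))) (at x)"
    by (rule has_vector_derivative_real_field) (auto intro!: derivative_eq_intros)
  then show ?thesis by (simp add: cis_conv_exp mult.assoc)
qed

lemma smooth_fun_cis: "smooth_fun (\<lambda>x. cis (a * x))"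
proof (rule smooth_fun_coinduct[of _ "range (\<lambda>b x. b * cis (a * x))"])
  show "(\<lambda>x. cis (a * x)) \<in> range (\<lambda>b x. b * cis (a * x))"
    by (rule image_eqI[of _ _ 1]) auto
  fix g assume "g \<in> range (\<lambda>b x. b * cis (a * x))"
  then obtain b where g: "g = (\<lambda>x. b * cis (a * x))" by blast
  show "\<exists>g'\<in>range (\<lambda>b x. b * cis (a * x)). \<forall>x. (g has_vector_derivative g' x) (at x)"
    unfolding g
    using has_vector_derivative_mult_right[OF has_vector_derivative_cis, of b a]
    by (intro bexI[of _ "\<lambda>x. (b * (\<i> * complex_of_real a)) * cis (a * x)"] rangeI)
      (simp add: mult.assoc)
qed

lemma has_vector_derivative_affine:
  assumes "\<And>x. ((f :: real \<Rightarrow> complex) has_vector_derivative f' x) (at x)"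
  shows "((\<lambda>x. f (a * x + b)) has_vector_derivative of_real a * f' (a * x + b)) (at x)"
proof -
  have "((\<lambda>x. a * x + b) has_vector_derivative a) (at x)"
    by (auto intro!: derivative_eq_intros simp: has_real_derivative_iff_has_vector_derivative[symmetric])
  from vector_diff_chain_at[OF this assms]
  show ?thesis by (simp add: o_def scaleR_conv_of_real)
qed

lemma smooth_fun_affine:
  assumes "smooth_fun f"
  shows "smooth_fun (\<lambda>x. f (a * x + b))"
proof (rule smooth_fun_coinduct[of _ "{\<lambda>x. q * g (a * x + b) | q g. smooth_fun g}"])
  show "(\<lambda>x. f (a * x + b)) \<in> {\<lambda>x. q * g (a * x + b) | q g. smooth_fun g}"
    using assms by (auto intro!: exI[of _ 1] exI[of _ f])
  fix h assume "h \<in> {\<lambda>x. q * g (a * x + b) | q g. smooth_fun g}"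
  then obtain q g where h: "h = (\<lambda>x. q * g (a * x + b))" "smooth_fun g" by blast
  obtain g' where g': "smooth_fun g'" "\<And>x. (g has_vector_derivative g' x) (at x)"
    using smooth_fun_derivE[OF h(2)] by blast
  show "\<exists>g'\<in>{\<lambda>x. q * g (a * x + b) | q g. smooth_fun g}. \<forall>x. (h has_vector_derivative g' x) (at x)"
  proof (rule bexI[of _ "\<lambda>x. (q * of_real a) * g' (a * x + b)"])
    show "\<forall>x. (h has_vector_derivative q * of_real a * g' (a * x + b)) (at x)"
      unfolding h mult.assoc
      by (intro allI has_vector_derivative_mult_right has_vector_derivative_affine g'(2))
  qed (use g'(1) in blast)
qed

lemma has_vector_derivative_eventually_0:
  assumes "\<forall>\<^sub>F y in nhds x. f y = 0"
  shows "(f has_vector_derivative 0) (at x)"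
proof -
  obtain S where "open S" "x \<in> S" "\<And>y. y \<in> S \<Longrightarrow> f y = 0"
    using assms unfolding eventually_nhds by blast
  then show ?thesis
    using has_vector_derivative_transform_within_open[of "\<lambda>_. 0" 0 x S f] by simp
qed

text \<open>Where the denominator vanishes the quotient is 0 by convention, and so are all the
  quotients arising as its derivatives; hence no case distinction is needed.\<close>
lemma smooth_fun_divide:
  assumes "smooth_fun f" and u: "smooth_fun u"
    and "\<And>x. u x = 0 \<Longrightarrow> \<forall>\<^sub>F y in nhds x. f y = 0"
  shows "smooth_fun (\<lambda>x. f x / u x)"
proof (rule smooth_fun_coinduct)
  define S where "S = {\<lambda>x. g x / u x ^ j | g j. smooth_fun g \<and>
      (\<forall>x. u x = 0 \<longrightarrow> (\<forall>\<^sub>F y in nhds x. g y = 0))}"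
  show "(\<lambda>x. f x / u x) \<in> S"
    unfolding S_def using assms by (auto intro!: exI[of _ f] exI[of _ 1])
  fix h assume "h \<in> S"
  then obtain g j where h: "h = (\<lambda>x. g x / u x ^ j)" and g: "smooth_fun g"
    and van: "\<And>x. u x = 0 \<Longrightarrow> \<forall>\<^sub>F y in nhds x. g y = 0"
    unfolding S_def by blast
  obtain g' where g': "smooth_fun g'" "\<And>x. (g has_vector_derivative g' x) (at x)"
    using smooth_fun_derivE[OF g] by blast
  obtain u' where u': "smooth_fun u'" "\<And>x. (u has_vector_derivative u' x) (at x)"
    using smooth_fun_derivE[OF u] by blast
  \<comment> \<open>Numerator in the quotient rule for \<open>g / u ^ j\<close>, to be put over
    \<open>u ^ Suc j\<close>.\<close>
  define k where "k x = g' x * u x - of_nat j * (g x * u' x)" for x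
  have "smooth_fun k"
    unfolding k_def by (intro smooth_fun_diff smooth_fun_mult smooth_fun_const g g' u u')
  moreover have vank: "\<forall>\<^sub>F y in nhds x. k y = 0" if "u x = 0" for x
  proof -
    \<comment> \<open>A function vanishing near \<open>x\<close> also vanishes near each nearby
      \<open>y\<close>, so its derivative is 0 there too.\<close>
    have "\<forall>\<^sub>F y in nhds x. \<forall>\<^sub>F z in nhds y. g z = 0"
      using van[OF that] by (simp add: eventually_eventually)
    then show ?thesis
    proof eventually_elim
      case (elim y)
      have "g' y = 0" using has_vector_derivative_eventually_0[OF elim] g'(2) vector_derivative_unique_at by blast
      then show ?case using eventually_nhds_x_imp_x[OF elim] by (simp add: k_def)
    qed
  qed
  moreover have "(h has_vector_derivative k x / u x ^ Suc j) (at x)" for x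
  proof (cases "u x = 0")
    case True
    have ev: "\<forall>\<^sub>F y in nhds x. h y = 0"
      using van[OF True] by eventually_elim (simp add: h)
    then show ?thesis using True has_vector_derivative_eventually_0[OF ev] by simp
  next
    case False
    have "(h has_derivative (\<lambda>v. v *\<^sub>R (k x / u x ^ Suc j))) (at x)"
      unfolding h
      apply (rule derivative_eq_intros g'(2)[unfolded has_vector_derivative_def]
          u'(2)[unfolded has_vector_derivative_def] refl)+
      using False apply simp
      using False by (cases j; simp add: fun_eq_iff k_def field_simps scaleR_conv_of_real power2_eq_square power_add)
    then show ?thesis by (simp add: has_vector_derivative_def)
  qed
  ultimately show "\<exists>h'\<in>S. \<forall>x. (h has_vector_derivative h' x) (at x)"
    unfolding S_def
    by (intro bexI[of _ "\<lambda>x. k x / u x ^ Suc j"] CollectI exI[of _ k] exI[of _ "Suc j"]) auto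
qed

section \<open>A smooth step and a smooth partition of unity\<close>

definition flat :: "nat \<Rightarrow> real \<Rightarrow> complex" where
  "flat k x = (if x > 0 then of_real ((1 / x) ^ k * exp (- (1 / x))) else 0)"

lemma flat_tendsto_0: "((\<lambda>x::real. (1 / x) ^ k * exp (- (1 / x))) \<longlongrightarrow> 0) (at_right 0)"
proof -
  have "((\<lambda>x::real. x ^ k / exp x) \<longlongrightarrow> 0) at_top" by (rule tendsto_power_div_exp_0)
  from filterlim_compose[OF this filterlim_inverse_at_top_right]
  show ?thesis by (simp add: exp_minus divide_inverse)
qed

text \<open>The powers of 1/x are carried in \<open>flat\<close> so that each derivative is again a
  combination of members of the family; smoothness then follows by induction on the order.\<close>

lemma flat_has_vector_derivative:
  "(flat k has_vector_derivative (flat (k + 2) x - of_nat k * flat (k + 1) x)) (at x)"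
proof -
  consider "x > 0" | "x < 0" | "x = 0" by linarith
  then show ?thesis
  proof cases
    case 1
    have "((\<lambda>x. (1 / x) ^ k * exp (- (1 / x))) has_real_derivative
        ((1 / x) ^ (k + 2) * exp (- (1 / x)) - k * ((1 / x) ^ (k + 1) * exp (- (1 / x))))) (at x)"
      using 1
      apply (auto intro!: derivative_eq_intros)
      apply (cases k; simp add: field_simps power2_eq_square)
      done
    then have "((\<lambda>x. complex_of_real ((1 / x) ^ k * exp (- (1 / x)))) has_vector_derivative
        of_real ((1 / x) ^ (k + 2) * exp (- (1 / x)) - k * ((1 / x) ^ (k + 1) * exp (- (1 / x))))) (at x)"
      by (intro has_vector_derivative_of_real)
    then have "(flat k has_vector_derivative
        of_real ((1 / x) ^ (k + 2) * exp (- (1 / x)) - k * ((1 / x) ^ (k + 1) * exp (- (1 / x))))) (at x)"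
      by (rule has_vector_derivative_transform_within_open[of _ _ _ "{0<..}"]) (use 1 in \<open>auto simp: flat_def\<close>)
    then show ?thesis using 1 by (simp add: flat_def)
  next
    case 2
    have "(flat k has_vector_derivative 0) (at x)"
      by (rule has_vector_derivative_transform_within_open[of "\<lambda>_. 0" _ _ "{..<0}"]) (use 2 in \<open>auto simp: flat_def\<close>)
    then show ?thesis using 2 by (simp add: flat_def)
  next
    case 3
    \<comment> \<open>To the right of 0 the difference quotient of \<open>flat k\<close> is
      \<open>flat (k + 1)\<close>, which tends to 0 since the exponential beats every power.\<close>
    have r: "((\<lambda>y. (flat k y - flat k 0) /\<^sub>R (y - 0)) \<longlongrightarrow> 0) (at_right 0)"
    proof -
      have "((\<lambda>y. complex_of_real ((1 / y) ^ (k + 1) * exp (- (1 / y)))) \<longlongrightarrow> of_real 0) (at_right 0)"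
        by (intro tendsto_of_real flat_tendsto_0)
      then show ?thesis unfolding of_real_0
        by (rule Lim_transform_eventually)
          (auto simp: flat_def eventually_at_filter scaleR_conv_of_real divide_inverse[symmetric] divide_simps)
    qed
    have l: "((\<lambda>y. (flat k y - flat k 0) /\<^sub>R (y - 0)) \<longlongrightarrow> 0) (at_left 0)"
      by (rule tendsto_eventually) (auto simp: flat_def eventually_at_filter)
    have "((\<lambda>y. (flat k y - flat k 0) /\<^sub>R (y - 0)) \<longlongrightarrow> 0) (at 0)"
      using l r by (simp add: filterlim_split_at)
    then have "(flat k has_vector_derivative 0) (at 0)"
      unfolding has_vector_derivative_def has_derivative_at
      by (auto dest: tendsto_norm_zero simp: divide_inverse mult.commute)
    then show ?thesis using 3 by (simp add: flat_def)
  qed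
qed

lemma smooth_fun_flat: "smooth_fun (flat k)"
proof -
  have "diff_times n (flat k)" for n
  proof (induction n arbitrary: k)
    case (Suc n)
    have "diff_times n (\<lambda>x. - of_nat k :: complex)"
      using smooth_fun_const smooth_fun_iff_diff_times by blast
    then have "diff_times n (\<lambda>x. flat (k + 2) x + (- of_nat k) * flat (k + 1) x)"
      by (intro diff_times_add diff_times_mult Suc)
    then show ?case
      using flat_has_vector_derivative[of k]
      by (auto intro!: exI[of _ "\<lambda>x. flat (k + 2) x + (- of_nat k) * flat (k + 1) x"])
  qed simp
  then show ?thesis by (simp add: smooth_fun_iff_diff_times)
qed

definition smooth_step :: "real \<Rightarrow> complex" where
  "smooth_step x = flat 0 x / (flat 0 x + flat 0 (1 - x))"

lemma smooth_fun_smooth_step: "smooth_fun smooth_step"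
proof -
  have nz: "flat 0 x + flat 0 (1 - x) \<noteq> 0" for x
  proof -
    have "flat 0 x + flat 0 (1 - x) = of_real ((if x > 0 then exp (- (1 / x)) else 0) +
        (if x < 1 then exp (- (1 / (1 - x))) else 0))" by (simp add: flat_def)
    moreover have "(if x > 0 then exp (- (1 / x)) else 0) +
        (if x < 1 then exp (- (1 / (1 - x))) else 0) > (0::real)"
      by (auto intro: add_pos_pos)
    ultimately show ?thesis by (metis less_irrefl of_real_eq_0_iff)
  qed
  have "smooth_fun (\<lambda>x. flat 0 (1 - x))"
    using smooth_fun_affine[OF smooth_fun_flat, of 0 "-1" 1] by simp
  then show ?thesis
    unfolding smooth_step_def[abs_def]
    by (intro smooth_fun_divide smooth_fun_add smooth_fun_flat) (use nz in auto)
qed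

lemma smooth_step_eq_0: "x \<le> 0 \<Longrightarrow> smooth_step x = 0"
  by (simp add: smooth_step_def flat_def)

lemma smooth_step_eq_1: "x \<ge> 1 \<Longrightarrow> smooth_step x = 1"
  by (simp add: smooth_step_def flat_def)

text \<open>As a difference of two translates of one step, \<open>bump\<close> has integer
  translates whose sum telescopes to 1, so the partition of unity needs no normalising
  division.\<close>

definition bump :: "real \<Rightarrow> complex" where
  "bump x = smooth_step (x + 1) - smooth_step x"

lemma smooth_fun_bump: "smooth_fun (\<lambda>x. bump (a * x + b))"
  using smooth_fun_affine[OF smooth_fun_smooth_step, of a "b + 1"]
    smooth_fun_affine[OF smooth_fun_smooth_step, of a b]
  by (simp add: bump_def smooth_fun_diff add.assoc)

lemma bump_eq_0: "\<bar>x\<bar> \<ge> 1 \<Longrightarrow> bump x = 0"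
  by (cases "x \<ge> 0") (auto simp: bump_def smooth_step_eq_0 smooth_step_eq_1)

lemma bump_partition:
  assumes "\<bar>x\<bar> \<le> real N"
  shows "(\<Sum>k\<in>{- int N..int N}. bump (x - of_int k)) = 1"
proof -
  have "(\<Sum>k\<in>{- int N..int N}. bump (x - of_int k)) =
      (\<Sum>i<2 * N + 1. smooth_step (x + N + 1 - real i) - smooth_step (x + N + 1 - real (Suc i)))"
    by (rule sum.reindex_bij_witness[of _ "\<lambda>i. int i - int N" "\<lambda>k. nat (k + int N)"])
      (auto simp: bump_def algebra_simps)
  also have "\<dots> = smooth_step (x + N + 1) - smooth_step (x + N + 1 - real (2 * N + 1))"
    by (subst sum_lessThan_telescope') simp
  also have "\<dots> = 1"
    using assms by (subst smooth_step_eq_0, force, subst smooth_step_eq_1) auto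
  finally show ?thesis .
qed

section \<open>Test functions and decay of their Fourier transforms\<close>

lemma smooth_fun_continuous: "smooth_fun f \<Longrightarrow> continuous_on S f"
  by (metis continuous_at_imp_continuous_on has_vector_derivative_continuous smooth_fun_derivE)

lemma smooth_fun_measurable: "smooth_fun f \<Longrightarrow> f \<in> borel_measurable borel"
  by (rule borel_measurable_continuous_onI) (rule smooth_fun_continuous)

lemma test_funI:
  assumes "smooth_fun f" "compact K" "K \<subseteq> U" "\<And>x. x \<notin> K \<Longrightarrow> f x = 0"
  shows "test_fun U f"
proof -
  have "closure {x. f x \<noteq> 0} \<subseteq> K"
    using assms by (intro closure_minimal compact_imp_closed) auto
  moreover from this have "compact (closure {x. f x \<noteq> 0})"
    using assms(2) by (metis closed_Int_compact closed_closure inf.absorb1)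
  ultimately show ?thesis using assms by (auto simp: test_fun_def)
qed

lemma test_funE:
  assumes "test_fun U f"
  obtains K where "smooth_fun f" "compact K" "K \<subseteq> U" "\<And>x. x \<notin> K \<Longrightarrow> f x = 0"
  using assms that[of "closure {x. f x \<noteq> 0}"] closure_subset[of "{x. f x \<noteq> 0}"]
  unfolding test_fun_def by blast

lemma test_fun_smooth: "test_fun U f \<Longrightarrow> smooth_fun f"
  by (simp add: test_fun_def)

lemma test_fun_mono: "test_fun U f \<Longrightarrow> U \<subseteq> V \<Longrightarrow> test_fun V f"
  by (auto simp: test_fun_def)

lemma test_fun_UNIV: "test_fun U f \<Longrightarrow> test_fun UNIV f"
  by (rule test_fun_mono) auto

lemma test_fun_bound_support:
  assumes "test_fun U f"
  obtains R where "R > 0" "\<And>x. R \<le> \<bar>x\<bar> \<Longrightarrow> f x = 0"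
proof -
  obtain K where K: "compact K" "\<And>x. x \<notin> K \<Longrightarrow> f x = 0" using test_funE[OF assms] by metis
  obtain R where R: "\<And>x. x \<in> K \<Longrightarrow> \<bar>x\<bar> \<le> R"
    using compact_imp_bounded[OF K(1)] by (auto simp: bounded_iff)
  have "f x = 0" if "\<bar>R\<bar> + 1 \<le> \<bar>x\<bar>" for x
    using K(2)[of x] R[of x] that by linarith
  then show ?thesis using that[of "\<bar>R\<bar> + 1"] by auto
qed

lemma test_fun_mult:
  assumes "test_fun U f" "smooth_fun g"
  shows "test_fun U (\<lambda>x. f x * g x)"
  using assms by (elim test_funE) (rule test_funI, auto intro: smooth_fun_mult)

lemma test_fun_add:
  assumes "test_fun U f" "test_fun U g"
  shows "test_fun U (\<lambda>x. f x + g x)"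
proof -
  obtain K where K: "smooth_fun f" "compact K" "K \<subseteq> U" "\<And>x. x \<notin> K \<Longrightarrow> f x = 0"
    using test_funE[OF assms(1)] by metis
  obtain L where L: "smooth_fun g" "compact L" "L \<subseteq> U" "\<And>x. x \<notin> L \<Longrightarrow> g x = 0"
    using test_funE[OF assms(2)] by metis
  show ?thesis
    by (rule test_funI[of _ "K \<union> L"]) (use K L in \<open>auto intro: smooth_fun_add\<close>)
qed

lemma test_fun_derivE:
  assumes "test_fun U f"
  obtains f' where "test_fun U f'" "\<And>x. (f has_vector_derivative f' x) (at x)"
proof -
  obtain K where K: "smooth_fun f" "compact K" "K \<subseteq> U" "\<And>x. x \<notin> K \<Longrightarrow> f x = 0"
    using test_funE[OF assms(1)] by metis
  obtain f' where f': "smooth_fun f'" "\<And>x. (f has_vector_derivative f' x) (at x)"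
    using smooth_fun_derivE[OF K(1)] by metis
  have "f' x = 0" if "x \<notin> K" for x
  proof -
    have "\<forall>\<^sub>F y in nhds x. f y = 0"
      using K compact_imp_closed[OF K(2)] that
      by (auto simp: eventually_nhds intro!: exI[of _ "- K"])
    then show ?thesis
      using f'(2) has_vector_derivative_eventually_0 vector_derivative_unique_at by blast
  qed
  then show ?thesis using that[OF _ f'(2)] test_funI[OF f'(1) K(2,3)] by blast
qed

lemma compact_support_integrable:
  fixes f :: "real \<Rightarrow> complex"
  assumes "continuous_on UNIV f" "\<And>x. R \<le> \<bar>x\<bar> \<Longrightarrow> f x = 0"
  shows "integrable lborel f"
proof -
  have "integrable lborel (\<lambda>x. indicator {-R..R} x *\<^sub>R f x)"
    using assms(1) by (intro borel_integrable_compact) (auto intro: continuous_on_subset)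
  also have "(\<lambda>x. indicator {-R..R} x *\<^sub>R f x) = f"
    using assms(2) by (force simp: fun_eq_iff indicator_def)
  finally show ?thesis .
qed

lemma continuous_on_cis_mult: "continuous_on S (\<lambda>x. cis (a * x))"
  by (rule smooth_fun_continuous[OF smooth_fun_cis])

lemma test_fun_integrable:
  assumes "test_fun U f" "continuous_on UNIV g"
  shows "integrable lborel (\<lambda>x. g x * f x)"
proof -
  obtain R where "\<And>x. R \<le> \<bar>x\<bar> \<Longrightarrow> f x = 0" using test_fun_bound_support[OF assms(1)] by metis
  then show ?thesis using assms
    by (intro compact_support_integrable[of _ R] continuous_intros smooth_fun_continuous[of f])
      (auto simp: test_fun_def)
qed

lemma test_fun_integrable': "test_fun U f \<Longrightarrow> integrable lborel f"
  using test_fun_integrable[of U f "\<lambda>_. 1"] by simp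

lemma test_fun_integrable_cis: "test_fun U f \<Longrightarrow> integrable lborel (\<lambda>x. cis (a * x) * f x)"
  by (intro test_fun_integrable continuous_on_cis_mult)

lemma fourier_integrable: "test_fun U f \<Longrightarrow> integrable lborel (\<lambda>x. cis (- (t * x)) * f x)"
  using test_fun_integrable_cis[of U f "- t"] by simp

section \<open>Fourier transforms of test functions\<close>

lemma integral_test_fun_derivative:
  assumes "test_fun U f" "\<And>x. (f has_vector_derivative f' x) (at x)" "continuous_on UNIV f'"
  shows "(LINT x|lborel. f' x) = 0"
proof -
  obtain R where R: "R > 0" "\<And>x. R \<le> \<bar>x\<bar> \<Longrightarrow> f x = 0"
    using test_fun_bound_support[OF assms(1)] by metis
  have "f' x = 0" if "\<bar>x\<bar> > R" for x
  proof -
    have "\<forall>\<^sub>F y in nhds x. f y = 0"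
      using R that by (auto simp: eventually_nhds intro!: exI[of _ "{y. R < \<bar>y\<bar>}"] open_Collect_less continuous_intros)
    then show ?thesis
      using assms(2) has_vector_derivative_eventually_0 vector_derivative_unique_at by blast
  qed
  then have "f' = (\<lambda>x. indicator {-R..R} x *\<^sub>R f' x)"
    by (force simp: indicator_def)
  then have "(LINT x|lborel. f' x) = (LINT x|lborel. indicator {-R..R} x *\<^sub>R f' x)" by simp
  also have "\<dots> = f R - f (- R)"
    using R assms by (intro integral_FTC_Icc) (auto intro: has_vector_derivative_at_within continuous_on_subset)
  finally show ?thesis using R by auto
qed

text \<open>Integration by parts: the derivative of \<open>f x * cis (- t * x)\<close> integrates to
  0.\<close>

lemma fourier_derivative:
  assumes f: "test_fun U f" and f': "test_fun U f'" "\<And>x. (f has_vector_derivative f' x) (at x)"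
  shows "fourier f' t = \<i> * of_real t * fourier f t"
proof -
  have c: "((\<lambda>x. f x * cis (- t * x)) has_vector_derivative
      (f x * (\<i> * complex_of_real (-t) * cis (- t * x)) + f' x * cis (- t * x))) (at x)" for x
    by (intro has_vector_derivative_mult f'(2) has_vector_derivative_cis)
  have "(LINT x|lborel. f x * (\<i> * complex_of_real (-t) * cis (- t * x)) + f' x * cis (- t * x)) = 0"
    by (rule integral_test_fun_derivative[OF test_fun_mult[OF f smooth_fun_cis] c])
      (intro continuous_intros smooth_fun_continuous[OF test_fun_smooth[OF f]]
        smooth_fun_continuous[OF test_fun_smooth[OF f'(1)]] continuous_on_cis_mult)
  also have "(\<lambda>x. f x * (\<i> * complex_of_real (-t) * cis (- t * x)) + f' x * cis (- t * x)) =
      (\<lambda>x. cis (- (t * x)) * f' x - \<i> * complex_of_real t * (cis (- (t * x)) * f x))"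
    by (simp add: fun_eq_iff algebra_simps)
  also have "(LINT x|lborel. \<dots> x) = fourier f' t - \<i> * of_real t * fourier f t"
    unfolding fourier_def
    by (subst Bochner_Integration.integral_diff)
      (use fourier_integrable[OF f] fourier_integrable[OF f'(1)] in auto)
  finally show ?thesis by simp
qed

lemma fourier_add:
  assumes "test_fun U f" "test_fun V g"
  shows "fourier (\<lambda>x. f x + g x) t = fourier f t + fourier g t"
  unfolding fourier_def distrib_left
  by (intro Bochner_Integration.integral_add fourier_integrable[OF assms(1)] fourier_integrable[OF assms(2)])

lemma fourier_cmult: "fourier (\<lambda>x. a * f x) t = a * fourier f t"
proof -
  have "(\<lambda>x. cis (- (t * x)) * (a * f x)) = (\<lambda>x. a * (cis (- (t * x)) * f x))"
    by (simp add: fun_eq_iff)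
  then show ?thesis by (simp add: fourier_def)
qed

lemma fourier_modulate: "fourier (\<lambda>x. f x * cis (- (s * x))) t = fourier f (t + s)"
proof -
  have "cis (- (t * x)) * (f x * cis (- (s * x))) = cis (- ((t + s) * x)) * f x" for x
    by (subst mult.left_commute) (simp add: cis_mult algebra_simps)
  then show ?thesis unfolding fourier_def by presburger
qed

lemma norm_fourier_le:
  assumes "\<And>x. a \<le> x \<Longrightarrow> x \<le> b \<Longrightarrow> norm (f x) \<le> B" "\<And>x. x < a \<or> b < x \<Longrightarrow> f x = 0"
    "a \<le> b" "test_fun U f"
  shows "norm (fourier f t) \<le> B * (b - a)"
proof -
  have "norm (fourier f t) \<le> (LINT x|lborel. B * indicator {a..b} x)"
    unfolding fourier_def
  proof (rule Bochner_Integration.integral_norm_bound_integral)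
    show "norm (cis (- (t * x)) * f x) \<le> B * indicator {a..b} x" for x
      using assms(1,2)[of x] by (cases "x \<in> {a..b}") (auto simp: norm_mult)
  qed (use fourier_integrable[OF assms(4)] in \<open>auto intro!: integrable_mult_right integrable_real_indicator simp: emeasure_lborel_Icc_eq\<close>)
  then show ?thesis using assms(3) by simp
qed

lemma test_fun_bounded:
  assumes "test_fun U f"
  obtains B where "B > 0" "\<And>x. norm (f x) \<le> B"
proof -
  obtain R where R: "R > 0" "\<And>x. R \<le> \<bar>x\<bar> \<Longrightarrow> f x = 0"
    using test_fun_bound_support[OF assms] by metis
  have "compact (f ` {-R..R})"
    by (intro compact_continuous_image smooth_fun_continuous test_fun_smooth[OF assms]) auto
  from compact_imp_bounded[OF this]
  obtain B where "\<forall>y\<in>f ` {-R..R}. norm y \<le> B"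
    by (auto simp: bounded_iff)
  then have B: "\<And>x. x \<in> {-R..R} \<Longrightarrow> norm (f x) \<le> B" by blast
  have "norm (f x) \<le> \<bar>B\<bar> + 1" for x
    using B[of x] R(2)[of x] by (cases "\<bar>x\<bar> < R") (auto simp: abs_if split: if_splits)
  then show ?thesis using that[of "\<bar>B\<bar> + 1"] by auto
qed

lemma fourier_bounded:
  assumes "test_fun U f"
  obtains B where "B > 0" "\<And>t. norm (fourier f t) \<le> B"
proof -
  obtain R where R: "R > 0" "\<And>x. R \<le> \<bar>x\<bar> \<Longrightarrow> f x = 0"
    using test_fun_bound_support[OF assms] by metis
  obtain B where B: "B > 0" "\<And>x. norm (f x) \<le> B"
    using test_fun_bounded[OF assms] by metis
  have "norm (fourier f t) \<le> B * (R - (- R))" for t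
    using B R by (intro norm_fourier_le[OF _ _ _ assms]) auto
  then show ?thesis using that[of "B * (R - (- R))"] B R by auto
qed

lemma fourier_second_derivative:
  assumes "test_fun U f"
  obtains f'' where "test_fun U f''"
    "\<And>t. fourier f'' t = - of_real (t\<^sup>2) * fourier f t"
proof -
  obtain f' where f': "test_fun U f'" "\<And>x. (f has_vector_derivative f' x) (at x)"
    using test_fun_derivE[OF assms] by metis
  obtain f'' where f'': "test_fun U f''" "\<And>x. (f' has_vector_derivative f'' x) (at x)"
    using test_fun_derivE[OF f'(1)] by metis
  have "fourier f'' t = - of_real (t\<^sup>2) * fourier f t" for t
    using fourier_derivative[OF assms f'] fourier_derivative[OF f'(1) f'']
    by (simp add: power2_eq_square algebra_simps)
  then show ?thesis using that f'' by blast
qed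

text \<open>Powers of \<^term>\<open>1 + t\<^sup>2\<close> are absorbed by powers of the operator \<open>1 - (d/dx)\<^sup>2\<close>.\<close>
lemma fourier_decay:
  assumes "test_fun U f"
  obtains B where "B > 0" "\<And>t. norm (fourier f t) \<le> B / (1 + t\<^sup>2) ^ j"
proof -
  have "\<exists>g. test_fun U g \<and> (\<forall>t. fourier g t = of_real ((1 + t\<^sup>2) ^ j) * fourier f t)"
  proof (induction j)
    case 0
    then show ?case using assms by (intro exI[of _ f]) auto
  next
    case (Suc j)
    then obtain g where g: "test_fun U g" "\<And>t. fourier g t = of_real ((1 + t\<^sup>2) ^ j) * fourier f t"
      by blast
    obtain g'' where g'': "test_fun U g''" "\<And>t. fourier g'' t = - of_real (t\<^sup>2) * fourier g t"
      using fourier_second_derivative[OF g(1)] by metis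
    have t: "test_fun U (\<lambda>x. (-1) * g'' x)"
      using test_fun_mult[OF g''(1) smooth_fun_const[of "-1"]] by simp
    have "fourier (\<lambda>x. g x + (-1) * g'' x) t = of_real ((1 + t\<^sup>2) ^ Suc j) * fourier f t" for t
      by (subst fourier_add[OF g(1) t], subst fourier_cmult)
        (simp add: g g'' algebra_simps)
    then show ?case using test_fun_add[OF g(1) t] by blast
  qed
  then obtain g where g: "test_fun U g" "\<And>t. fourier g t = of_real ((1 + t\<^sup>2) ^ j) * fourier f t"
    by blast
  obtain B where B: "B > 0" "\<And>t. norm (fourier g t) \<le> B"
    using fourier_bounded[OF g(1)] by metis
  have "norm (fourier f t) \<le> B / (1 + t\<^sup>2) ^ j" for t
  proof -
    have p: "(1 + t\<^sup>2) ^ j > 0" by (simp add: add_pos_nonneg)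
    have "norm (fourier g t) = (1 + t\<^sup>2) ^ j * norm (fourier f t)"
      unfolding g(2) norm_mult norm_of_real using p by (simp only: abs_of_pos)
    then show ?thesis using p B(2)[of t] by (simp add: pos_le_divide_eq mult.commute)
  qed
  then show ?thesis using that B(1) by blast
qed

text \<open>Comparison with the integral of 1/(1 + s^2): a term is at most 3/d times the increment
  of \<open>arctan\<close> over one step of length \<open>d\<close>, and the increments telescope to
  at most pi. The bound is uniform in \<open>t\<close> and \<open>N\<close>, which later makes all
  estimates uniform in the frequency.\<close>

lemma sum_inverse_quadratic_le:
  assumes "0 < d" "d \<le> 1"
  shows "(\<Sum>k<N. 1 / (1 + (d * (t - real k))\<^sup>2)) \<le> 3 * pi / d"
proof -
  have step: "1 / (1 + (d * (t - real k))\<^sup>2) \<le>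
      3 / d * (arctan (d * (real (Suc k) - t)) - arctan (d * (real k - t)))" for k
  proof -
    define s where "s = d * (real k - t)"
    have "\<exists>z. s < z \<and> z < s + d \<and> arctan (s + d) - arctan s = (s + d - s) * inverse (1 + z\<^sup>2)"
      using assms by (intro MVT2) (auto intro!: derivative_eq_intros simp: divide_inverse)
    then obtain z where z: "s < z" "z < s + d" "arctan (s + d) - arctan s = d * inverse (1 + z\<^sup>2)"
      by auto
    \<comment> \<open>\<open>z\<close> lies within \<open>d \<le> 1\<close> of \<open>s\<close>,
      which costs at most a factor 3 in the weight.\<close>
    have "z\<^sup>2 \<le> (\<bar>s\<bar> + 1)\<^sup>2"
      using z assms by (intro abs_le_square_iff[THEN iffD1]) auto
    also have "\<dots> \<le> 2 + 2 * s\<^sup>2"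
      using sum_squares_bound[of "\<bar>s\<bar>" 1] by (simp add: power2_eq_square algebra_simps)
    also have "\<dots> \<le> 2 + 3 * s\<^sup>2" by simp
    finally have "1 + z\<^sup>2 \<le> 3 * (1 + s\<^sup>2)" by simp
    then have "1 / (1 + s\<^sup>2) \<le> 3 * inverse (1 + z\<^sup>2)"
      by (simp add: divide_simps add_pos_nonneg add_nonneg_eq_0_iff)
    also have "\<dots> = 3 / d * (arctan (s + d) - arctan s)"
      using z(3) assms by simp
    finally show ?thesis
      by (simp add: s_def power2_eq_square algebra_simps)
  qed
  have "(\<Sum>k<N. 1 / (1 + (d * (t - real k))\<^sup>2)) \<le>
      (\<Sum>k<N. 3 / d * (arctan (d * (real (Suc k) - t)) - arctan (d * (real k - t))))"
    by (intro sum_mono step)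
  also have "\<dots> = 3 / d * (arctan (d * (real N - t)) - arctan (d * (real 0 - t)))"
    by (subst sum_distrib_left[symmetric], subst sum_lessThan_telescope) simp
  also have "\<dots> \<le> 3 / d * pi"
    using assms arctan_ubound[of "d * (real N - t)"] arctan_lbound[of "d * (real 0 - t)"]
    by (intro mult_left_mono) auto
  finally show ?thesis by simp
qed

lemma summable_inverse_quadratic: "summable (\<lambda>k. 1 / (1 + (t - real k)\<^sup>2))"
  using sum_inverse_quadratic_le[of 1 t]
  by (intro summableI_nonneg_bounded[of _ "3 * pi"]) (auto simp: add_nonneg_nonneg)

lemma suminf_inverse_quadratic_le: "(\<Sum>k. 1 / (1 + (t - real k)\<^sup>2)) \<le> 3 * pi"
  using sum_inverse_quadratic_le[of 1 t]
  by (intro suminf_le_const summable_inverse_quadratic) auto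

section \<open>Radial limits against test functions\<close>

lemma integrable_inverse_quadratic: "integrable lborel (\<lambda>x::real. 1 / (1 + x\<^sup>2))"
  using integrable_inverse_1_plus_square by (simp add: set_integrable_def divide_inverse)

lemma fourier_integrable_lborel:
  assumes "test_fun U f"
  shows "integrable lborel (fourier f)"
proof -
  obtain B where B: "B > 0" "\<And>t. norm (fourier f t) \<le> B / (1 + t\<^sup>2) ^ 1"
    using fourier_decay[OF assms] by metis
  have [measurable]: "f \<in> borel_measurable borel"
    by (rule smooth_fun_measurable[OF test_fun_smooth[OF assms]])
  have [measurable]: "cis \<in> borel_measurable borel"
    using smooth_fun_measurable[OF smooth_fun_cis[of 1]] by simp
  have m: "fourier f \<in> borel_measurable lborel"
    unfolding fourier_def[abs_def] by measurable
  have "integrable lborel (\<lambda>t::real. B * (1 / (1 + t\<^sup>2)))"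
    by (intro integrable_mult_right integrable_inverse_quadratic)
  then show ?thesis
    by (rule Bochner_Integration.integrable_bound) (use m B in auto)
qed

section \<open>Cutting test functions into pieces of width \<delta>; localisation\<close>

lemma test_fun_piece:
  assumes "test_fun U f" "\<delta> > 0" "compact K" "\<And>x. x \<notin> K \<Longrightarrow> f x = 0"
    "K \<inter> {\<delta> * (of_int k - 1)..\<delta> * (of_int k + 1)} \<subseteq> V"
  shows "test_fun V (\<lambda>x. f x * bump (x / \<delta> - of_int k))"
proof (rule test_funI[OF _ _ assms(5)])
  show "smooth_fun (\<lambda>x. f x * bump (x / \<delta> - of_int k))"
    using smooth_fun_bump[of "1 / \<delta>" "- of_int k"]
    by (intro smooth_fun_mult test_fun_smooth[OF assms(1)]) simp
  show "compact (K \<inter> {\<delta> * (of_int k - 1)..\<delta> * (of_int k + 1)})"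
    using assms(3) by (simp add: compact_Int_closed)
  show "f x * bump (x / \<delta> - of_int k) = 0"
    if x: "x \<notin> K \<inter> {\<delta> * (of_int k - 1)..\<delta> * (of_int k + 1)}" for x
  proof (cases "x \<in> K")
    case True
    then have "1 \<le> \<bar>x / \<delta> - of_int k\<bar>"
      using x assms(2) by (auto simp: abs_if field_simps)
    then show ?thesis using bump_eq_0 by simp
  qed (use assms(4) in simp)
qed

lemma test_fun_piece_same:
  assumes "test_fun U f"
  shows "test_fun U (\<lambda>x. f x * bump (x / \<delta> - of_int k))"
  using smooth_fun_bump[of "1 / \<delta>" "- of_int k"] by (intro test_fun_mult assms) simp

lemma test_fun_partition:
  assumes "test_fun U f" "\<delta> > 0"
  obtains N where "f = (\<lambda>x. \<Sum>k\<in>{- int N..int N}. f x * bump (x / \<delta> - of_int k))"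
proof -
  obtain R where R: "\<And>x. R \<le> \<bar>x\<bar> \<Longrightarrow> f x = 0"
    using test_fun_bound_support[OF assms(1)] by metis
  obtain N where N: "R / \<delta> \<le> real N" using real_arch_simple by blast
  have "f x = (\<Sum>k\<in>{- int N..int N}. f x * bump (x / \<delta> - of_int k))" for x
  proof (cases "R \<le> \<bar>x\<bar>")
    case False
    then have "\<bar>x / \<delta>\<bar> \<le> R / \<delta>" using assms(2) by (simp add: divide_right_mono)
    with N have "\<bar>x / \<delta>\<bar> \<le> real N" by linarith
    from bump_partition[OF this] show ?thesis by (simp flip: sum_distrib_left)
  qed (simp add: R)
  then show ?thesis using that by blast
qed

text \<open>Membership is carried along with \<open>Q\<close> because \<open>add\<close> requires
  both summands to be test functions.\<close>

lemma test_fun_sum: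
  assumes "finite A" "\<And>k. k \<in> A \<Longrightarrow> test_fun U (f k)" "\<And>k. k \<in> A \<Longrightarrow> Q (f k)"
    and add: "\<And>f g. test_fun U f \<Longrightarrow> test_fun U g \<Longrightarrow> Q f \<Longrightarrow> Q g \<Longrightarrow> Q (\<lambda>x. f x + g x)"
    and zero: "Q (\<lambda>_. 0)"
  shows "test_fun U (\<lambda>x. \<Sum>k\<in>A. f k x) \<and> Q (\<lambda>x. \<Sum>k\<in>A. f k x)"
  using assms(1-3)
proof (induction A rule: finite_induct)
  case empty
  show ?case using zero by (auto intro: test_funI[of _ "{}"] smooth_fun_const)
next
  case (insert a A)
  then show ?case by (auto intro!: test_fun_add add)
qed

text \<open>A property stable under sums is local: by the Lebesgue number of the cover, all
  sufficiently narrow pieces of \<open>f\<close> lie in a single member.\<close>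

lemma test_fun_local_induct:
  assumes f: "test_fun U f"
    and add: "\<And>f g. test_fun U f \<Longrightarrow> test_fun U g \<Longrightarrow> Q f \<Longrightarrow> Q g \<Longrightarrow> Q (\<lambda>x. f x + g x)"
    and zero: "Q (\<lambda>_. 0)"
    and loc: "\<And>x. x \<in> U \<Longrightarrow> \<exists>V. open V \<and> x \<in> V \<and> (\<forall>g. test_fun U g \<longrightarrow> test_fun V g \<longrightarrow> Q g)"
  shows "Q f"
proof -
  obtain K where K: "compact K" "K \<subseteq> U" "\<And>x. x \<notin> K \<Longrightarrow> f x = 0"
    using test_funE[OF f] by metis
  define G where "G = {V. open V \<and> (\<forall>g. test_fun U g \<longrightarrow> test_fun V g \<longrightarrow> Q g)}"
  have "K \<subseteq> \<Union>G" using K(2) loc unfolding G_def by blast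
  then obtain e where e: "e > 0" "\<And>x. x \<in> K \<Longrightarrow> \<exists>V\<in>G. ball x e \<subseteq> V"
    using Heine_Borel_lemma[OF K(1), of G] unfolding G_def by blast
  \<comment> \<open>A piece occupies an interval of length 2\<delta> < e, hence lies in the
    \<open>e\<close>-ball about any of its points.\<close>
  define \<delta> where "\<delta> = e / 3"
  have \<delta>: "\<delta> > 0" using e by (simp add: \<delta>_def)
  obtain N where N: "f = (\<lambda>x. \<Sum>k\<in>{- int N..int N}. f x * bump (x / \<delta> - of_int k))"
    using test_fun_partition[OF f \<delta>] by metis
  have "Q (\<lambda>x. f x * bump (x / \<delta> - of_int k))" for k
  proof (cases "K \<inter> {\<delta> * (of_int k - 1)..\<delta> * (of_int k + 1)} = {}")
    case True
    then have "test_fun {} (\<lambda>x. f x * bump (x / \<delta> - of_int k))"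
      by (intro test_fun_piece[OF f \<delta> K(1,3)]) auto
    then have "(\<lambda>x. f x * bump (x / \<delta> - of_int k)) = (\<lambda>_. 0)"
      by (elim test_funE) blast
    then show ?thesis using zero by simp
  next
    case False
    then obtain x where x: "x \<in> K" "\<delta> * (of_int k - 1) \<le> x" "x \<le> \<delta> * (of_int k + 1)" by auto
    then obtain V where V: "V \<in> G" "ball x e \<subseteq> V" using e by blast
    have "{\<delta> * (of_int k - 1)..\<delta> * (of_int k + 1)} \<subseteq> ball x e"
      using \<delta> x by (auto simp: dist_real_def abs_less_iff \<delta>_def field_simps)
    with V(2) have "test_fun V (\<lambda>x. f x * bump (x / \<delta> - of_int k))"
      by (intro test_fun_piece[OF f \<delta> K(1,3)]) auto
    then show ?thesis using V(1) test_fun_piece_same[OF f] by (auto simp: G_def)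
  qed
  then show ?thesis
    using test_fun_sum[of "{- int N..int N}" U "\<lambda>k x. f x * bump (x / \<delta> - of_int k)" Q]
      test_fun_piece_same[OF f] add zero N by auto
qed

section \<open>Null test functions and boundary values of power series\<close>

definition boundary_null :: "(complex \<Rightarrow> complex) \<Rightarrow> (real \<Rightarrow> complex) \<Rightarrow> bool" where
  "boundary_null H \<phi> \<longleftrightarrow> (\<exists>\<tau>. (\<forall>n::nat. ((\<lambda>r. LINT \<theta>|lborel.
      H (complex_of_real r * cis \<theta>) * (\<phi> \<theta> * cis (- (real n * \<theta>)))) \<longlongrightarrow> \<tau> n) (at_left 1)) \<and> \<tau> \<longlonglongrightarrow> 0)"

lemma test_fun_modulate: "test_fun U f \<Longrightarrow> test_fun U (\<lambda>x. f x * cis (- (a * x)))"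
  using test_fun_mult[OF _ smooth_fun_cis[of "- a"]] by simp

lemma boundary_null_zero: "boundary_null H (\<lambda>_. 0)"
  unfolding boundary_null_def by (intro exI[of _ "\<lambda>_. 0"]) simp

text \<open>Both \<open>H (r * cis \<theta>)\<close> and the modulations by integer frequencies have
  period 2 pi in \<theta>.\<close>

lemma boundary_null_translate:
  assumes "boundary_null H (\<lambda>x. \<phi> (x + 2 * pi * of_int j))"
  shows "boundary_null H \<phi>"
proof -
  have "(LINT \<theta>|lborel. H (complex_of_real r * cis \<theta>) * (\<phi> \<theta> * cis (- (real n * \<theta>)))) =
     (LINT \<theta>|lborel. H (complex_of_real r * cis \<theta>) * (\<phi> (\<theta> + 2 * pi * of_int j) * cis (- (real n * \<theta>))))" for r n
  proof -
    have c: "cis (2 * pi * real_of_int j + \<theta>) = cis \<theta>" for \<theta>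
      by (simp add: cis_multiple_2pi flip: cis_mult)
    have "cis (- (real n * (2 * pi * real_of_int j + \<theta>))) = cis (- (real n * \<theta>))" for \<theta>
    proof -
      have "cis (- (real n * (2 * pi * real_of_int j + \<theta>))) =
          cis (2 * pi * real_of_int (- (int n * j))) * cis (- (real n * \<theta>))"
        by (simp add: cis_mult algebra_simps)
      then show ?thesis by (simp only: cis_multiple_2pi Ints_of_int) simp
    qed
    note c' = this
    have "(LINT \<theta>|lborel. H (complex_of_real r * cis \<theta>) * (\<phi> \<theta> * cis (- (real n * \<theta>)))) =
      (LINT \<theta>|lborel. H (complex_of_real r * cis (2 * pi * real_of_int j + \<theta>)) *
        (\<phi> (2 * pi * real_of_int j + \<theta>) * cis (- (real n * (2 * pi * real_of_int j + \<theta>)))))"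
      by (subst lborel_integral_real_affine[where c = 1 and t = "2 * pi * real_of_int j"]) auto
    then show ?thesis unfolding c c' by (simp only: add.commute)
  qed
  then show ?thesis using assms unfolding boundary_null_def by simp
qed

text \<open>Modulation translates the Fourier transform, so a change of variables evaluates \<psi>
  at \<open>n - u\<close>, which runs to infinity for each \<open>u\<close>. Dominated convergence
  applies since \<psi> is bounded and \<open>fourier f\<close> integrable.\<close>

lemma pseudofun_modulated_tendsto_0:
  assumes \<psi>: "\<psi> \<in> borel_measurable borel" "bounded (range \<psi>)" "(\<psi> \<longlongrightarrow> 0) at_infinity"
    and f: "test_fun V f"
  shows "(\<lambda>n. LINT t|lborel. \<psi> t * fourier (\<lambda>x. f x * cis (- (real n * x))) (- t)) \<longlonglongrightarrow> 0"
proof -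
  obtain B where B: "\<And>t. norm (\<psi> t) \<le> B" using \<psi>(2) by (auto simp: bounded_iff)
  have eq: "(LINT t|lborel. \<psi> t * fourier (\<lambda>x. f x * cis (- (real n * x))) (- t)) =
      (LINT u|lborel. \<psi> (real n - u) * fourier f u)" for n
    unfolding fourier_modulate
    by (subst lborel_integral_real_affine[where c = "-1" and t = "real n"]) auto
  have "(\<lambda>n. LINT u|lborel. \<psi> (real n - u) * fourier f u) \<longlonglongrightarrow> (LINT (u::real)|lborel. 0)"
  proof (rule integral_dominated_convergence[where w = "\<lambda>u. B * norm (fourier f u)"])
    have [measurable]: "fourier f \<in> borel_measurable lborel"
      using fourier_integrable_lborel[OF f] by auto
    note [measurable] = \<psi>(1)
    show "(\<lambda>u. \<psi> (real n - u) * fourier f u) \<in> borel_measurable lborel" for n by measurable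
    show "integrable lborel (\<lambda>u. B * norm (fourier f u))"
      using fourier_integrable_lborel[OF f] by auto
    show "AE u in lborel. (\<lambda>n. \<psi> (real n - u) * fourier f u) \<longlonglongrightarrow> 0"
    proof (rule AE_I2)
      fix u :: real
      have "filterlim (\<lambda>n. real n - u) at_top sequentially"
        using filterlim_tendsto_add_at_top[OF tendsto_const filterlim_real_sequentially, of "-u"] by simp
      then have "filterlim (\<lambda>n. real n - u) at_infinity sequentially"
        by (rule filterlim_at_top_imp_at_infinity)
      from filterlim_compose[OF \<psi>(3) this]
      show "(\<lambda>n. \<psi> (real n - u) * fourier f u) \<longlonglongrightarrow> 0" by (rule tendsto_mult_left_zero)
    qed
    show "AE u in lborel. norm (\<psi> (real n - u) * fourier f u) \<le> B * norm (fourier f u)" for n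
      using B by (auto simp: norm_mult intro!: mult_right_mono)
  qed auto
  then show ?thesis by (simp add: eq)
qed

text \<open>A locale because the same analysis is applied to two series: the given one and the one
  of the difference quotient at a boundary point.\<close>

locale power_series_disc =
  fixes c :: "nat \<Rightarrow> complex" and H :: "complex \<Rightarrow> complex"
  assumes sums: "norm z < 1 \<Longrightarrow> (\<lambda>n. c n * z ^ n) sums H z"
begin

lemma summable_norm:
  assumes "0 \<le> r" "r < 1"
  shows "summable (\<lambda>k. norm (c k) * r ^ k)"
proof -
  \<comment> \<open>Convergence at the larger radius \<open>s\<close> gives absolute convergence at
    \<open>r\<close>.\<close>
  obtain s where s: "r < s" "s < 1" using dense assms(2) by blast
  have "summable (\<lambda>n. norm (c n * complex_of_real r ^ n))"
    by (rule powser_insidea[of _ "complex_of_real s"])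
      (use s assms sums[of "complex_of_real s"] in \<open>auto simp: sums_iff\<close>)
  then show ?thesis using assms by (simp add: norm_mult norm_power)
qed

text \<open>For fixed \<open>r < 1\<close> the series is dominated by an absolutely summable one
  times \<open>norm (f \<theta>)\<close>, so it may be integrated term by term.\<close>

lemma
  assumes "0 \<le> r" "r < 1" and f: "test_fun U f"
  shows radial_integrable: "integrable lborel (\<lambda>\<theta>. H (of_real r * cis \<theta>) * f \<theta>)"
    and radial_sums: "(\<lambda>k. c k * of_real r ^ k * fourier f (- real k)) sums
      (LINT \<theta>|lborel. H (of_real r * cis \<theta>) * f \<theta>)"
proof -
  define g where "g k \<theta> = c k * of_real r ^ k * (cis (real k * \<theta>) * f \<theta>)" for k \<theta>
  have g: "g k \<theta> = c k * (of_real r * cis \<theta>) ^ k * f \<theta>" for k \<theta>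
    by (simp add: g_def power_mult_distrib Complex.DeMoivre)
  have int: "integrable lborel (g k)" for k
    unfolding g_def by (intro integrable_mult_right test_fun_integrable_cis[OF f])
  have ng: "norm (g k \<theta>) = norm (c k) * r ^ k * norm (f \<theta>)" for k \<theta>
    using assms by (simp add: g_def norm_mult norm_power)
  have summ: "summable (\<lambda>k. norm (g k \<theta>))" for \<theta>
    unfolding ng by (intro summable_mult2 summable_norm assms)
  have summ': "summable (\<lambda>k. LINT \<theta>|lborel. norm (g k \<theta>))"
    unfolding ng by (subst Bochner_Integration.integral_mult_right_zero)
       (intro summable_mult2 summable_norm assms)
  have "(\<lambda>k. c k * (of_real r * cis \<theta>) ^ k) sums H (of_real r * cis \<theta>)" for \<theta>
    using assms by (intro sums) (simp add: norm_mult)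
  from sums_mult2[OF this] have eq: "(\<Sum>k. g k \<theta>) = H (of_real r * cis \<theta>) * f \<theta>" for \<theta>
    unfolding g by (rule sums_unique[symmetric])
  show "integrable lborel (\<lambda>\<theta>. H (of_real r * cis \<theta>) * f \<theta>)"
    using integrable_suminf[OF int _ summ'] summ by (simp add: eq)
  have "(\<lambda>k. LINT \<theta>|lborel. g k \<theta>) sums (LINT \<theta>|lborel. (\<Sum>k. g k \<theta>))"
    using sums_integral[OF int _ summ'] summ by simp
  then show "(\<lambda>k. c k * of_real r ^ k * fourier f (- real k)) sums
      (LINT \<theta>|lborel. H (of_real r * cis \<theta>) * f \<theta>)"
    unfolding eq by (simp add: g_def fourier_def)
qed

lemma radial_modulated_sums:
  assumes "0 \<le> r" "r < 1" and f: "test_fun U f"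
  shows "(\<lambda>k. c k * of_real r ^ k * fourier f (real n - real k)) sums
      (LINT \<theta>|lborel. H (of_real r * cis \<theta>) * (f \<theta> * cis (- (real n * \<theta>))))"
  using radial_sums[OF assms(1,2) test_fun_modulate[OF f, of "real n"]]
  by (simp add: fourier_modulate add.commute)

lemma eventually_at_left_1: "\<forall>\<^sub>F r in at_left (1::real). 0 \<le> r \<and> r < 1"
  by (rule eventually_mono[OF eventually_at_left_real[of 0 1]]) auto

lemma boundary_null_add:
  assumes f: "test_fun U f" "boundary_null H f" and g: "test_fun U g" "boundary_null H g"
  shows "boundary_null H (\<lambda>x. f x + g x)"
proof -
  define I where "I f n r = (LINT \<theta>|lborel.
      H (complex_of_real r * cis \<theta>) * (f \<theta> * cis (- (real n * \<theta>))))" for f n r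
  obtain \<tau> where \<tau>: "\<And>n. (I f n \<longlongrightarrow> \<tau> n) (at_left 1)" "\<tau> \<longlonglongrightarrow> 0"
    using f(2) unfolding boundary_null_def I_def by blast
  obtain \<sigma> where \<sigma>: "\<And>n. (I g n \<longlongrightarrow> \<sigma> n) (at_left 1)" "\<sigma> \<longlonglongrightarrow> 0"
    using g(2) unfolding boundary_null_def I_def by blast
  have "I (\<lambda>x. f x + g x) n r = I f n r + I g n r" if "0 \<le> r \<and> r < 1" for n r
    unfolding I_def distrib_left distrib_right
    using that by (intro Bochner_Integration.integral_add
        radial_integrable[OF _ _ test_fun_modulate[OF f(1)]]
        radial_integrable[OF _ _ test_fun_modulate[OF g(1)]]) auto
  then have "(I (\<lambda>x. f x + g x) n \<longlongrightarrow> \<tau> n + \<sigma> n) (at_left 1)" for n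
    by (intro Lim_transform_eventually[OF tendsto_add[OF \<tau>(1) \<sigma>(1)]]
        eventually_mono[OF eventually_at_left_1]) auto
  moreover have "(\<lambda>n. \<tau> n + \<sigma> n) \<longlonglongrightarrow> 0" using tendsto_add[OF \<tau>(2) \<sigma>(2)] by simp
  ultimately show ?thesis
    unfolding boundary_null_def I_def by (intro exI[of _ "\<lambda>n. \<tau> n + \<sigma> n"] conjI allI)
qed

lemma boundary_null_local:
  assumes "test_fun U f"
    "\<And>x. x \<in> U \<Longrightarrow> \<exists>V. open V \<and> x \<in> V \<and> (\<forall>g. test_fun V g \<longrightarrow> boundary_null H g)"
  shows "boundary_null H f"
proof (rule test_fun_local_induct[OF assms(1) boundary_null_add boundary_null_zero])
  show "\<exists>V. open V \<and> x \<in> V \<and> (\<forall>g. test_fun U g \<longrightarrow> test_fun V g \<longrightarrow> boundary_null H g)"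
    if "x \<in> U" for x
    using assms(2)[OF that] by blast
qed

text \<open>Where \<open>T\<close> is a pseudofunction, the radial limits are its values at
  modulated test functions, and these decay by \<open>pseudofun_modulated_tendsto_0\<close>.
  Localisation extends this to all of \<open>U\<close>.\<close>

lemma lpf_boundary_imp_null:
  assumes "lpf_boundary H U" "test_fun U f"
  shows "boundary_null H f"
proof -
  obtain T where T: "\<And>\<phi>. test_fun U \<phi> \<Longrightarrow>
      ((\<lambda>r. LINT \<theta>|lborel. H (complex_of_real r * cis \<theta>) * \<phi> \<theta>) \<longlongrightarrow> T \<phi>) (at_left 1)"
    and loc: "local_pseudofun U T"
    using assms(1) unfolding lpf_boundary_def by blast
  show ?thesis
  proof (rule boundary_null_local[OF assms(2)])
    fix x assume "x \<in> U"
    then obtain V where V: "open V" "x \<in> V" "V \<subseteq> U" "pseudofun_on V T"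
      using loc unfolding local_pseudofun_def by blast
    obtain \<psi> where \<psi>: "\<psi> \<in> borel_measurable borel" "bounded (range \<psi>)" "(\<psi> \<longlongrightarrow> 0) at_infinity"
      and T\<psi>: "\<And>\<phi>. test_fun V \<phi> \<Longrightarrow>
        T \<phi> = (LINT t|lborel. \<psi> t * fourier \<phi> (- t)) / complex_of_real (2 * pi)"
      using V(4) unfolding pseudofun_on_def by blast
    have "boundary_null H g" if g: "test_fun V g" for g
      unfolding boundary_null_def
    proof (intro exI[of _ "\<lambda>n. T (\<lambda>x. g x * cis (- (real n * x)))"] conjI allI)
      show "((\<lambda>r. LINT \<theta>|lborel. H (complex_of_real r * cis \<theta>) * (g \<theta> * cis (- (real n * \<theta>))))
          \<longlongrightarrow> T (\<lambda>x. g x * cis (- (real n * x)))) (at_left 1)" for n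
        using g V(3) by (intro T test_fun_modulate) (rule test_fun_mono)
      have "(\<lambda>n. (LINT t|lborel. \<psi> t * fourier (\<lambda>x. g x * cis (- (real n * x))) (- t)) /
          complex_of_real (2 * pi)) \<longlonglongrightarrow> 0 / complex_of_real (2 * pi)"
        by (intro tendsto_divide pseudofun_modulated_tendsto_0[OF \<psi> g] tendsto_const) simp
      then show "(\<lambda>n. T (\<lambda>x. g x * cis (- (real n * x)))) \<longlonglongrightarrow> 0"
        using T\<psi> test_fun_modulate[OF g] by simp
    qed
    then show "\<exists>V. open V \<and> x \<in> V \<and> (\<forall>g. test_fun V g \<longrightarrow> boundary_null H g)"
      using V by blast
  qed
qed

text \<open>The fast decay of \<open>fourier f\<close> absorbs linear growth of the coefficients,
  and Tannery's theorem moves the limit in \<open>r\<close> under the sum. Linear growth is the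
  right generality because it is the first bound available for the coefficients of a difference
  quotient.\<close>

lemma
  assumes "\<And>k. norm (c k) \<le> C * (1 + real k)" and f: "test_fun U f"
  shows summable_coeff_fourier: "summable (\<lambda>k. norm (c k * fourier f (real n - real k)))"
    and radial_limit: "((\<lambda>r. LINT \<theta>|lborel. H (of_real r * cis \<theta>) * (f \<theta> * cis (- (real n * \<theta>)))) \<longlongrightarrow>
      (\<Sum>k. c k * fourier f (real n - real k))) (at_left 1)"
proof -
  obtain B where B: "B > 0" "\<And>t. norm (fourier f t) \<le> B / (1 + t\<^sup>2) ^ 2"
    using fourier_decay[OF f] by metis
  have C: "C \<ge> 0" using order_trans[OF norm_ge_zero assms(1)[of 0]] by simp
  have bd: "norm (c k * fourier f (real n - real k)) \<le>
      C * (2 * (1 + real n)) * B * (1 / (1 + (real n - real k)\<^sup>2))" for k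
  proof -
    define m where "m = real n - real k"
    \<comment> \<open>Growth in \<open>k\<close> is traded for growth in the fixed \<open>n\<close>
      and one factor \<open>1 + m\<^sup>2\<close>; the second such factor in the decay keeps the sum
      finite.\<close>
    have "1 + real k \<le> (1 + real n) * (1 + \<bar>m\<bar>)"
    proof -
      have "real k \<le> real n + \<bar>m\<bar>" by (simp add: m_def)
      moreover have "(1 + real n) * (1 + \<bar>m\<bar>) = 1 + real n + \<bar>m\<bar> + real n * \<bar>m\<bar>"
        by (simp add: algebra_simps)
      moreover have "0 \<le> real n * \<bar>m\<bar>" by simp
      ultimately show ?thesis by linarith
    qed
    also have "\<dots> \<le> (1 + real n) * (2 * (1 + m\<^sup>2))"
    proof (intro mult_left_mono)
      have "0 \<le> (\<bar>m\<bar> - 1)\<^sup>2" by simp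
      then have "2 * \<bar>m\<bar> \<le> m\<^sup>2 + 1" unfolding power2_diff by simp
      moreover have "0 \<le> m\<^sup>2" by simp
      ultimately show "1 + \<bar>m\<bar> \<le> 2 * (1 + m\<^sup>2)" by argo
    qed auto
    finally have k: "1 + real k \<le> (2 * (1 + real n)) * (1 + m\<^sup>2)" by (simp only: ac_simps)
    have "norm (c k * fourier f m) \<le> (C * (1 + real k)) * (B / (1 + m\<^sup>2) ^ 2)"
      unfolding norm_mult using assms(1)[of k] B C by (intro mult_mono) auto
    also have "\<dots> \<le> (C * ((2 * (1 + real n)) * (1 + m\<^sup>2))) * (B / (1 + m\<^sup>2) ^ 2)"
      using C B(1) k by (intro mult_right_mono mult_left_mono) auto
    also have "\<dots> = C * (2 * (1 + real n)) * B * (1 / (1 + m\<^sup>2))"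
      by (simp add: power2_eq_square[of "1 + m\<^sup>2"] divide_simps add_nonneg_eq_0_iff)
    finally show ?thesis by (simp add: m_def)
  qed
  show summ: "summable (\<lambda>k. norm (c k * fourier f (real n - real k)))"
    by (rule summable_comparison_test'[OF summable_mult[OF summable_inverse_quadratic]])
      (use bd in simp)
  have "((\<lambda>r. \<Sum>k. c k * of_real r ^ k * fourier f (real n - real k)) \<longlongrightarrow>
      (\<Sum>k. c k * fourier f (real n - real k))) (at_left 1)"
  proof (rule tannerys_theorem[where M = "\<lambda>k. norm (c k * fourier f (real n - real k))",
        THEN conjunct2, THEN conjunct2])
    show "((\<lambda>r. c k * of_real r ^ k * fourier f (real n - real k)) \<longlongrightarrow>
        c k * fourier f (real n - real k)) (at_left 1)" for k
    proof -
      have "((\<lambda>r. c k * of_real r ^ k * fourier f (real n - real k)) \<longlongrightarrow>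
          c k * of_real 1 ^ k * fourier f (real n - real k)) (at_left 1)"
        by (intro tendsto_intros)
      then show ?thesis by simp
    qed
    have "\<forall>\<^sub>F x in at_top \<times>\<^sub>F at_left (1::real). True \<and> (0 \<le> snd x \<and> snd x < 1)"
      by (rule eventually_prodI[OF eventually_True eventually_at_left_1])
    then show "\<forall>\<^sub>F (k, r) in at_top \<times>\<^sub>F at_left 1. norm (c k * of_real r ^ k * fourier f (real n - real k))
        \<le> norm (c k * fourier f (real n - real k))"
    proof eventually_elim
      case (elim x)
      obtain k r where x: "x = (k, r)" by force
      have "r ^ k \<le> 1" using elim x by (intro power_le_one) auto
      then have "norm (c k) * r ^ k * norm (fourier f (real n - real k)) \<le>
          norm (c k) * 1 * norm (fourier f (real n - real k))"
        by (intro mult_right_mono mult_left_mono) auto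
      then show ?case using elim x by (simp add: norm_mult norm_power)
    qed
  qed (use summ in auto)
  then show "((\<lambda>r. LINT \<theta>|lborel. H (of_real r * cis \<theta>) * (f \<theta> * cis (- (real n * \<theta>)))) \<longlongrightarrow>
      (\<Sum>k. c k * fourier f (real n - real k))) (at_left 1)"
    by (rule Lim_transform_eventually)
      (use radial_modulated_sums[OF _ _ f] in \<open>auto intro!: eventually_mono[OF eventually_at_left_1] sums_unique[symmetric]\<close>)
qed

lemma boundary_null_iff:
  assumes "\<And>k. norm (c k) \<le> C * (1 + real k)" and f: "test_fun U f"
  shows "boundary_null H f \<longleftrightarrow> (\<lambda>n. \<Sum>k. c k * fourier f (real n - real k)) \<longlonglongrightarrow> 0"
proof
  assume "boundary_null H f"
  then obtain \<tau> where \<tau>: "\<And>n. ((\<lambda>r. LINT \<theta>|lborel.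
      H (complex_of_real r * cis \<theta>) * (f \<theta> * cis (- (real n * \<theta>)))) \<longlongrightarrow> \<tau> n) (at_left 1)" "\<tau> \<longlonglongrightarrow> 0"
    unfolding boundary_null_def by blast
  have "\<tau> n = (\<Sum>k. c k * fourier f (real n - real k))" for n
    by (rule tendsto_unique[OF _ \<tau>(1) radial_limit[OF assms]]) simp
  then have "\<tau> = (\<lambda>n. \<Sum>k. c k * fourier f (real n - real k))" by blast
  then show "(\<lambda>n. \<Sum>k. c k * fourier f (real n - real k)) \<longlonglongrightarrow> 0" using \<tau>(2) by simp
next
  assume "(\<lambda>n. \<Sum>k. c k * fourier f (real n - real k)) \<longlonglongrightarrow> 0"
  then show "boundary_null H f"
    unfolding boundary_null_def
    by (intro exI[of _ "\<lambda>n. \<Sum>k. c k * fourier f (real n - real k)"] conjI allI radial_limit[OF assms])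
qed

end

section \<open>Recovering the coefficients, and Fourier bounds for small pieces\<close>

text \<open>The translates of this bump by multiples of 2 pi sum to 1, so at integers its transform
  agrees with the Fourier coefficients of the constant 1. In the proof the bump is a step minus its
  translate by the period \<open>a\<close>; with an antiderivative \<open>G\<close> only [a, 2a],
  where the step equals 1, contributes.\<close>

lemma fourier_unit_bump:
  "fourier (\<lambda>x. bump (x / (2 * pi))) (of_int m) = (if m = 0 then of_real (2 * pi) else 0)"
proof -
  define a where "a = 2 * pi"
  have a: "a > 0" by (simp add: a_def)
  define e where "e x = cis (- (of_int m * x))" for x
  define g where "g x = e x * smooth_step (x / a)" for x
  have per: "e (x + a) = e x" for x
  proof -
    have "e (x + a) = e x * cis (2 * pi * of_int (- m))"
      by (simp add: e_def a_def cis_mult algebra_simps)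
    then show ?thesis by (simp only: cis_multiple_2pi Ints_of_int) simp
  qed
  have cont_e: "continuous_on S e" for S
    using continuous_on_cis_mult[of S "- of_int m"] by (simp add: e_def[abs_def])
  have cont: "continuous_on S g" for S
    using smooth_fun_continuous[OF smooth_fun_affine[OF smooth_fun_smooth_step], of S "1 / a" 0] cont_e[of S]
    by (simp add: g_def[abs_def] continuous_on_mult)
  \<comment> \<open>The interval strictly contains [-a, 2a], so that \<open>G\<close> has two-sided
    derivatives wherever they are used.\<close>
  obtain G where G: "\<And>x. x \<in> {-2*a..3*a} \<Longrightarrow> (G has_vector_derivative g x) (at x within {-2*a..3*a})"
    using antiderivative_continuous[OF cont, of "-2*a" "3*a"] by metis
  have G': "(G has_vector_derivative g x) (at x)" if "-2*a < x" "x < 3*a" for x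
    using G[of x] that by (simp add: at_within_Icc_at)
  have eq: "e x * bump (x / a) = indicator {-a..a} x *\<^sub>R (g (x + a) - g x)" for x
  proof -
    have "e x * bump (x / a) = g (x + a) - g x"
      using a by (simp add: g_def per bump_def add_divide_distrib right_diff_distrib)
    moreover have "bump (x / a) = 0" if "x \<notin> {-a..a}"
      using that a by (intro bump_eq_0) (auto simp: field_simps abs_if)
    ultimately show ?thesis by (auto simp: indicator_def)
  qed
  have "(LINT x|lborel. indicator {-a..a} x *\<^sub>R (g (x + a) - g x)) =
      (G (a + a) - G a) - (G (- a + a) - G (- a))"
  proof (rule integral_FTC_Icc[where F = "\<lambda>x. G (x + a) - G x"])
    fix x assume x: "- a \<le> x" "x \<le> a"
    have "((\<lambda>x. x + a) has_vector_derivative 1) (at x)"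
      by (auto intro!: derivative_eq_intros)
    moreover have "(G has_vector_derivative g (x + a)) (at (x + a))" "(G has_vector_derivative g x) (at x)"
      using x a by (auto intro!: G')
    ultimately have "((\<lambda>x. G (x + a)) has_vector_derivative g (x + a)) (at x)"
      using vector_diff_chain_at[of "\<lambda>x. x + a" 1 x G "g (x + a)"] by (simp add: o_def)
    from has_vector_derivative_diff[OF this \<open>(G has_vector_derivative g x) (at x)\<close>]
    show "((\<lambda>x. G (x + a) - G x) has_vector_derivative g (x + a) - g x) (at x within {-a..a})"
      by (rule has_vector_derivative_at_within)
  next
    show "continuous_on {- a..a} (\<lambda>x. g (x + a) - g x)"
      by (rule continuous_on_diff[OF continuous_on_compose2[OF cont[of UNIV]] cont])
        (auto intro!: continuous_on_add continuous_on_id continuous_on_const)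
  qed (use a in auto)
  moreover have "G 0 - G (- a) = 0"
  proof -
    have "(LINT x|lborel. indicator {-a..0} x *\<^sub>R g x) = G 0 - G (- a)"
      using a by (intro integral_FTC_Icc has_vector_derivative_at_within[OF G'] cont) auto
    moreover have "indicator {-a..0} x *\<^sub>R g x = 0" for x
      using a by (auto simp: indicator_def g_def smooth_step_eq_0 divide_le_0_iff)
    ultimately show ?thesis by simp
  qed
  moreover have "G (2 * a) - G a = (if m = 0 then of_real a else 0)"
  proof -
    define K where "K x = (if m = 0 then complex_of_real x else e x * \<i> / of_int m)" for x
    have K: "(K has_vector_derivative e x) (at x)" for x
    proof (cases "m = 0")
      case True
      have "(complex_of_real has_vector_derivative 1) (at x)"
        using has_vector_derivative_of_real[OF DERIV_ident] by simp
      then show ?thesis using True by (simp add: K_def[abs_def] e_def)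
    next
      case False
      have "((\<lambda>x. cis (- of_int m * x) * (\<i> / of_int m)) has_vector_derivative
          (\<i> * complex_of_real (- of_int m) * cis (- of_int m * x)) * (\<i> / of_int m)) (at x)"
        by (intro has_vector_derivative_mult_left has_vector_derivative_cis)
      moreover have "- (\<i> * (z * \<i>)) = z" for z by (simp add: algebra_simps)
      ultimately show ?thesis using False by (simp add: K_def[abs_def] e_def[abs_def])
    qed
    have "(LINT x|lborel. indicator {a..2*a} x *\<^sub>R g x) = G (2 * a) - G a"
      using a by (intro integral_FTC_Icc has_vector_derivative_at_within[OF G'] cont) auto
    moreover have "indicator {a..2*a} x *\<^sub>R g x = indicator {a..2*a} x *\<^sub>R e x" for x
      using a by (auto simp: indicator_def g_def smooth_step_eq_1)
    moreover have "(LINT x|lborel. indicator {a..2*a} x *\<^sub>R e x) = K (2 * a) - K a"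
      using a by (intro integral_FTC_Icc has_vector_derivative_at_within[OF K] cont_e) auto
    moreover have "K (2 * a) - K a = (if m = 0 then of_real a else 0)"
      using per[of a] by (simp add: K_def)
    ultimately show ?thesis by simp
  qed
  ultimately show ?thesis
    unfolding fourier_def by (simp add: eq e_def[symmetric] a_def[symmetric])
qed

lemma test_fun_unit_bump: "test_fun UNIV (\<lambda>x. bump (a * x + b))" if "a > 0"
proof (rule test_funI[OF smooth_fun_bump, of "{(-1 - b) / a..(1 - b) / a}"])
  show "bump (a * x + b) = 0" if "x \<notin> {(-1 - b) / a..(1 - b) / a}" for x
    using that \<open>a > 0\<close> by (intro bump_eq_0) (auto simp: field_simps abs_if)
qed auto

text \<open>Tested with the bump of \<open>fourier_unit_bump\<close>, the radial sum collapses to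
  its \<open>n\<close>-th term at every \<open>r < 1\<close>. The conclusion is thus available
  before any bound on the coefficients.\<close>

lemma (in power_series_disc) coeffs_tendsto_0:
  assumes "\<And>f. test_fun UNIV f \<Longrightarrow> boundary_null H f"
  shows "c \<longlonglongrightarrow> 0"
proof -
  define b where "b x = bump (x / (2 * pi))" for x
  have tb: "test_fun UNIV b"
    using test_fun_unit_bump[of "1 / (2 * pi)" 0] by (simp add: b_def[abs_def])
  obtain \<tau> where \<tau>: "\<And>n. ((\<lambda>r. LINT \<theta>|lborel.
      H (complex_of_real r * cis \<theta>) * (b \<theta> * cis (- (real n * \<theta>)))) \<longlongrightarrow> \<tau> n) (at_left 1)" "\<tau> \<longlonglongrightarrow> 0"
    using assms[OF tb] unfolding boundary_null_def by blast
  have b: "fourier b (real n - real k) = (if k = n then of_real (2 * pi) else 0)" for n k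
    using fourier_unit_bump[of "int n - int k"] by (simp add: b_def[abs_def])
  have "\<tau> n = c n * of_real (2 * pi)" for n
  proof -
    have "(LINT \<theta>|lborel. H (complex_of_real r * cis \<theta>) * (b \<theta> * cis (- (real n * \<theta>)))) =
        c n * of_real r ^ n * of_real (2 * pi)" if "0 \<le> r \<and> r < 1" for r
    proof -
      have "(\<lambda>k. c k * of_real r ^ k * fourier b (real n - real k)) =
          (\<lambda>k. if k = n then c k * of_real r ^ k * of_real (2 * pi) else 0)"
        by (simp add: b fun_eq_iff)
      moreover have "(\<lambda>k. c k * of_real r ^ k * fourier b (real n - real k)) sums
          (LINT \<theta>|lborel. H (complex_of_real r * cis \<theta>) * (b \<theta> * cis (- (real n * \<theta>))))"
        using that by (intro radial_modulated_sums[OF _ _ tb]) auto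
      ultimately show ?thesis
        using sums_unique2[OF _ sums_single[of n "\<lambda>k. c k * of_real r ^ k * of_real (2 * pi)"]]
        by (simp only:)
    qed
    then have "((\<lambda>r. c n * of_real r ^ n * of_real (2 * pi)) \<longlongrightarrow> \<tau> n) (at_left 1)"
      by (intro Lim_transform_eventually[OF \<tau>(1)] eventually_mono[OF eventually_at_left_1])
    moreover have "((\<lambda>r. c n * of_real r ^ n * of_real (2 * pi)) \<longlongrightarrow>
        c n * of_real 1 ^ n * of_real (2 * pi)) (at_left 1)"
      by (intro tendsto_intros)
    ultimately have "\<tau> n = c n * of_real 1 ^ n * of_real (2 * pi)"
      by (rule tendsto_unique[rotated]) simp
    then show ?thesis by simp
  qed
  then have "c = (\<lambda>n. \<tau> n / of_real (2 * pi))" by auto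
  then show ?thesis using tendsto_divide[OF \<tau>(2) tendsto_const, of "of_real (2 * pi)"] by simp
qed

section \<open>Fourier bounds for a narrow piece times a vanishing factor\<close>

lemma norm_1_minus_cis_le: "norm (1 - cis x) \<le> \<bar>x\<bar>"
proof (rule power2_le_imp_le)
  have "(norm (1 - cis x))\<^sup>2 = (1 - cos x)\<^sup>2 + (sin x)\<^sup>2" by (simp add: cmod_power2)
  also have "\<dots> = 2 * (1 - cos x)"
    using sin_cos_squared_add[of x] by (simp add: power2_eq_square algebra_simps)
  also have "\<dots> = 4 * (sin (x / 2))\<^sup>2"
    using cos_double_sin[of "x / 2"] by simp
  also have "\<dots> \<le> 4 * (x / 2)\<^sup>2"
    using abs_sin_x_le_abs_x[of "x / 2"] by (intro mult_left_mono abs_le_square_iff[THEN iffD1]) auto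
  finally show "(norm (1 - cis x))\<^sup>2 \<le> \<bar>x\<bar>\<^sup>2" by (simp add: power2_eq_square)
qed simp

text \<open>Makes the rule usable for derivatives computed by explicit formulas, which uniqueness
  identifies with those supplied by \<open>test_fun_derivE\<close>.\<close>

lemma fourier_second_derivative_unique:
  assumes "test_fun U f" "\<And>x. (f has_vector_derivative f' x) (at x)"
    "\<And>x. (f' has_vector_derivative f'' x) (at x)"
  shows "test_fun U f''" "fourier f'' t = - of_real (t\<^sup>2) * fourier f t"
proof -
  obtain g' where g': "test_fun U g'" "\<And>x. (f has_vector_derivative g' x) (at x)"
    using test_fun_derivE[OF assms(1)] by metis
  have eq: "g' = f'" using g'(2) assms(2) vector_derivative_unique_at by blast
  obtain g'' where g'': "test_fun U g''" "\<And>x. (g' has_vector_derivative g'' x) (at x)"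
    using test_fun_derivE[OF g'(1)] by metis
  have eq2: "g'' = f''"
    using g''(2) assms(3) vector_derivative_unique_at unfolding eq by blast
  show "test_fun U f''" using g''(1) eq2 by simp
  show "fourier f'' t = - of_real (t\<^sup>2) * fourier f t"
    using fourier_derivative[OF assms(1) g'] fourier_derivative[OF g'(1) g''] eq2
    by (simp add: power2_eq_square algebra_simps)
qed

text \<open>The factor vanishing at \<open>\<theta>\<close> gains a power of \<open>\<delta>\<close>, which makes the \<open>\<ell>\<^sup>1\<close> norm of the
  Fourier coefficients of a piece of width \<open>\<delta>\<close> of order \<open>\<delta>\<close>.\<close>
lemma fourier_piece_bound:
  assumes f: "test_fun UNIV f"
  shows "\<exists>A>0. \<forall>\<delta> k \<theta> t. 0 < \<delta> \<longrightarrow> \<delta> \<le> 1 \<longrightarrow> \<theta> \<in> {\<delta> * (of_int k - 1)..\<delta> * (of_int k + 1)} \<longrightarrow>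
      norm (fourier (\<lambda>x. (1 - cis (x - \<theta>)) * (f x * bump (x / \<delta> - of_int k))) t)
        \<le> A * \<delta>\<^sup>2 / (1 + (\<delta> * t)\<^sup>2)"
proof -
  obtain f' where f': "test_fun UNIV f'" "\<And>x. (f has_vector_derivative f' x) (at x)"
    using test_fun_derivE[OF f] by metis
  obtain f'' where f'': "test_fun UNIV f''" "\<And>x. (f' has_vector_derivative f'' x) (at x)"
    using test_fun_derivE[OF f'(1)] by metis
  have b: "test_fun {-1..1} bump"
    using smooth_fun_bump[of 1 0] by (intro test_funI[of _ "{-1..1}"] bump_eq_0) auto
  obtain b' where b': "test_fun {-1..1} b'" "\<And>x. (bump has_vector_derivative b' x) (at x)"
    using test_fun_derivE[OF b] by metis
  obtain b'' where b'': "test_fun {-1..1} b''" "\<And>x. (b' has_vector_derivative b'' x) (at x)"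
    using test_fun_derivE[OF b'(1)] by metis
  have outside: "g x = 0" if "test_fun {-1..1} g" "\<bar>x\<bar> > 1" for g x
    using that by (elim test_funE) force
  obtain P0 where P0: "P0 > 0" "\<And>x. norm (f x) \<le> P0" using test_fun_bounded[OF f] by metis
  obtain P1 where P1: "P1 > 0" "\<And>x. norm (f' x) \<le> P1" using test_fun_bounded[OF f'(1)] by metis
  obtain P2 where P2: "P2 > 0" "\<And>x. norm (f'' x) \<le> P2" using test_fun_bounded[OF f''(1)] by metis
  obtain P3 where P3: "P3 > 0" "\<And>x. norm (bump x) \<le> P3" using test_fun_bounded[OF b] by metis
  obtain P4 where P4: "P4 > 0" "\<And>x. norm (b' x) \<le> P4" using test_fun_bounded[OF b'(1)] by metis
  obtain P5 where P5: "P5 > 0" "\<And>x. norm (b'' x) \<le> P5" using test_fun_bounded[OF b''(1)] by metis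
  define P where "P = P0 + P1 + P2 + P3 + P4 + P5"
  have P: "P > 0" "\<And>x. norm (f x) \<le> P" "\<And>x. norm (f' x) \<le> P" "\<And>x. norm (f'' x) \<le> P"
    "\<And>x. norm (bump x) \<le> P" "\<And>x. norm (b' x) \<le> P" "\<And>x. norm (b'' x) \<le> P"
    unfolding P_def using P0 P1 P2 P3 P4 P5
    by (auto intro: order_trans[OF P0(2)] order_trans[OF P1(2)] order_trans[OF P2(2)]
      order_trans[OF P3(2)] order_trans[OF P4(2)] order_trans[OF P5(2)])
  \<comment> \<open>30 = 4 + 26: the transform of the product is at most
    \<open>4 * P\<^sup>2 * \<delta>\<^sup>2\<close>, that of its second derivative at most
    \<open>26 * P\<^sup>2\<close>, each being a supremum times the length 2\<delta> of the
    supporting interval.\<close>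
  have main: "norm (fourier (\<lambda>x. (1 - cis (x - \<theta>)) * (f x * bump (x / \<delta> - of_int k))) t)
        \<le> 30 * P\<^sup>2 * \<delta>\<^sup>2 / (1 + (\<delta> * t)\<^sup>2)"
    if \<delta>: "0 < \<delta>" "\<delta> \<le> 1" and \<theta>: "\<theta> \<in> {\<delta> * (of_int k - 1)..\<delta> * (of_int k + 1)}" for \<delta> k \<theta> t
  proof -
    define J where "J = {\<delta> * (of_int k - 1)..\<delta> * (of_int k + 1)}"
    define y where "y x = x / \<delta> - of_int k" for x
    define q where "q = complex_of_real (1 / \<delta>)"
    define v v' v'' where "v x = 1 - cis (x - \<theta>)" and "v' x = - (\<i> * cis (x - \<theta>))"
      and "v'' x = cis (x - \<theta>)" for x
    define g where "g x = bump (y x)" for x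
    define g' where "g' x = q * b' (y x)" for x
    define g'' where "g'' x = q * (q * b'' (y x))" for x
    have cis': "((\<lambda>x. cis (x - \<theta>)) has_vector_derivative \<i> * cis (x - \<theta>)) (at x)" for x
      using has_vector_derivative_affine[OF has_vector_derivative_cis[of 1], of 1 "- \<theta>"] by simp
    have dv: "(v has_vector_derivative v' x) (at x)" for x
      unfolding v_def[abs_def] v'_def
      using has_vector_derivative_diff[OF has_vector_derivative_const cis', of 1] by simp
    have dv': "(v' has_vector_derivative v'' x) (at x)" for x
      unfolding v'_def[abs_def] v''_def
      using has_vector_derivative_minus[OF has_vector_derivative_mult_right[OF cis', of \<i>]] by simp
    have dg: "(g has_vector_derivative g' x) (at x)" for x
      using has_vector_derivative_affine[OF b'(2), of "1 / \<delta>" "- of_int k"]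
      by (simp add: g_def[abs_def] g'_def y_def q_def)
    have dg': "(g' has_vector_derivative g'' x) (at x)" for x
      using has_vector_derivative_mult_right[OF has_vector_derivative_affine[OF b''(2), of "1 / \<delta>" "- of_int k"], of q]
      by (simp add: g'_def[abs_def] g''_def y_def q_def)
    define F where "F x = v x * (f x * g x)" for x
    define F' where "F' x = v x * (f x * g' x + f' x * g x) + v' x * (f x * g x)" for x
    define F'' where "F'' x = (v x * ((f x * g'' x + f' x * g' x) + (f' x * g' x + f'' x * g x))
        + v' x * (f x * g' x + f' x * g x)) + (v' x * (f x * g' x + f' x * g x) + v'' x * (f x * g x))" for x
    have dF: "(F has_vector_derivative F' x) (at x)" for x
      unfolding F_def[abs_def] F'_def
      by (intro has_vector_derivative_mult dv f' dg)
    have dF': "(F' has_vector_derivative F'' x) (at x)" for x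
      unfolding F'_def[abs_def] F''_def
      by (intro has_vector_derivative_mult has_vector_derivative_add dv dv' f' f'' dg dg')
    have tF: "test_fun UNIV F"
    proof -
      have "smooth_fun v"
        unfolding v_def[abs_def]
        using smooth_fun_affine[OF smooth_fun_cis[of 1], of 1 "- \<theta>"]
        by (intro smooth_fun_diff smooth_fun_const) simp
      then have "test_fun UNIV (\<lambda>x. (f x * g x) * v x)"
        using test_fun_mult[OF test_fun_piece_same[OF f, of \<delta> k], of v] by (simp add: g_def y_def)
      then show ?thesis by (simp add: F_def[abs_def] mult.commute)
    qed
    have out: "g x = 0 \<and> g' x = 0 \<and> g'' x = 0" if "x \<notin> J" for x
    proof -
      have "\<bar>y x\<bar> > 1" using that \<delta> by (auto simp: y_def J_def abs_if field_simps)
      then show ?thesis using outside b b' b'' by (simp add: g_def g'_def g''_def)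
    qed
    have nq: "norm q = 1 / \<delta>" using \<delta> by (simp add: q_def norm_divide)
    have d1: "1 \<le> 1 / \<delta>" using \<delta> by simp
    have ng: "norm (g x) \<le> P" "norm (g' x) \<le> P * (1 / \<delta>)" "norm (g'' x) \<le> P * (1 / \<delta>) * (1 / \<delta>)" for x
      using P(5,6,7)[of "y x"] \<delta>
      by (simp_all add: g_def g'_def g''_def norm_mult nq field_simps)
    have P1: "P \<le> P * (1 / \<delta>)" using d1 P(1) by (metis mult.right_neutral mult_left_mono less_imp_le)
    have P2: "P * (1 / \<delta>) \<le> P * (1 / \<delta>) * (1 / \<delta>)"
      using d1 P(1) \<delta> mult_left_mono[of 1 "1 / \<delta>" "P * (1 / \<delta>)"] by simp
    have nv: "norm (v x) \<le> 2 * \<delta>" if "x \<in> J" for x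
    proof -
      have "norm (v x) \<le> \<bar>x - \<theta>\<bar>" unfolding v_def by (rule norm_1_minus_cis_le)
      also have "\<dots> \<le> 2 * \<delta>" using that \<theta> by (auto simp: J_def algebra_simps abs_if)
      finally show ?thesis .
    qed
    have nv': "norm (v' x) = 1" "norm (v'' x) = 1" for x
      by (simp_all add: v'_def v''_def norm_mult)
    have m: "norm (a * b) \<le> A * B" if "norm a \<le> A" "norm b \<le> B" for a b :: complex and A B
      using that unfolding norm_mult by (intro mult_mono) (auto intro: order_trans[OF norm_ge_zero])
    have ad: "norm (a + b) \<le> A + B" if "norm a \<le> A" "norm b \<le> B" for a b :: complex and A B
      using that norm_triangle_ineq[of a b] by linarith
    have J: "x \<in> J" if "\<delta> * (of_int k - 1) \<le> x" "x \<le> \<delta> * (of_int k + 1)" for x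
      using that by (simp add: J_def)
    have J': "x \<notin> J" if "x < \<delta> * (of_int k - 1) \<or> \<delta> * (of_int k + 1) < x" for x
      using that by (auto simp: J_def)
    have len: "\<delta> * (of_int k + 1) - \<delta> * (of_int k - 1) = 2 * \<delta>" by (simp add: algebra_simps)
    have "norm (fourier F t) \<le> (2 * \<delta> * (P * P)) * (\<delta> * (of_int k + 1) - \<delta> * (of_int k - 1))"
    proof (rule norm_fourier_le[OF _ _ _ tF])
      show "norm (F x) \<le> 2 * \<delta> * (P * P)" if "\<delta> * (of_int k - 1) \<le> x" "x \<le> \<delta> * (of_int k + 1)" for x
        unfolding F_def by (intro m nv J that P ng)
      show "F x = 0" if "x < \<delta> * (of_int k - 1) \<or> \<delta> * (of_int k + 1) < x" for x
        using out[OF J'[OF that]] by (simp add: F_def)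
    qed (use \<delta> in auto)
    then have n1: "norm (fourier F t) \<le> 4 * P\<^sup>2 * \<delta>\<^sup>2"
      unfolding len by (simp add: power2_eq_square algebra_simps)
    have "norm (fourier F'' t) \<le> (13 * P\<^sup>2 * (1 / \<delta>)) * (\<delta> * (of_int k + 1) - \<delta> * (of_int k - 1))"
    proof (rule norm_fourier_le[OF _ _ _ fourier_second_derivative_unique(1)[OF tF dF dF']])
      \<comment> \<open>Each derivative of the bump costs 1/\<delta>, while the undifferentiated
        factor \<open>v\<close> gains 2\<delta> on \<open>J\<close>. The terms add up to 8 + 2 + 2 +
        1 = 13 multiples of \<open>P\<^sup>2 / \<delta>\<close>.\<close>
      show "norm (F'' x) \<le> 13 * P\<^sup>2 * (1 / \<delta>)"
        if x: "\<delta> * (of_int k - 1) \<le> x" "x \<le> \<delta> * (of_int k + 1)" for x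
      proof -
        have P': "norm a \<le> P * (1 / \<delta>)" if "norm a \<le> P" for a :: complex
          using that P1 by linarith
        have P'': "norm a \<le> P * (1 / \<delta>) * (1 / \<delta>)" if "norm a \<le> P * (1 / \<delta>)" for a :: complex
          using that P2 by linarith
        have "norm (F'' x) \<le> ((2 * \<delta>) * ((P * (P * (1 / \<delta>) * (1 / \<delta>)) + P * (P * (1 / \<delta>) * (1 / \<delta>)))
              + (P * (P * (1 / \<delta>) * (1 / \<delta>)) + P * (P * (1 / \<delta>) * (1 / \<delta>))))
            + 1 * (P * (P * (1 / \<delta>)) + P * (P * (1 / \<delta>)))) +
            (1 * (P * (P * (1 / \<delta>)) + P * (P * (1 / \<delta>))) + 1 * (P * (P * (1 / \<delta>))))"
          unfolding F''_def
          by (intro m ad nv[OF J[OF x]] P(2-4) ng(2,3) P''[OF ng(2)] P''[OF P'[OF ng(1)]] P'[OF ng(1)]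
            eq_refl[OF nv'(1)] eq_refl[OF nv'(2)])
        also have "\<dots> = 13 * P\<^sup>2 * (1 / \<delta>)"
          using \<delta> by (simp add: field_simps power2_eq_square)
        finally show ?thesis .
      qed
      show "F'' x = 0" if "x < \<delta> * (of_int k - 1) \<or> \<delta> * (of_int k + 1) < x" for x
        using out[OF J'[OF that]] by (simp add: F''_def)
    qed (use \<delta> in auto)
    then have "norm (fourier F'' t) \<le> 26 * P\<^sup>2" unfolding len using \<delta> by simp
    moreover have "norm (fourier F'' t) = t\<^sup>2 * norm (fourier F t)"
      unfolding fourier_second_derivative_unique(2)[OF tF dF dF'] by (simp add: norm_mult norm_power)
    ultimately have n2: "\<delta>\<^sup>2 * (t\<^sup>2 * norm (fourier F t)) \<le> \<delta>\<^sup>2 * (26 * P\<^sup>2)"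
      by (intro mult_left_mono) auto
    have "(1 + (\<delta> * t)\<^sup>2) * norm (fourier F t) \<le> 30 * P\<^sup>2 * \<delta>\<^sup>2"
      using n1 n2 by (simp add: algebra_simps power_mult_distrib)
    then have "norm (fourier F t) \<le> 30 * P\<^sup>2 * \<delta>\<^sup>2 / (1 + (\<delta> * t)\<^sup>2)"
      by (simp add: pos_le_divide_eq add_pos_nonneg mult.commute)
    then show ?thesis by (simp add: F_def[abs_def] v_def g_def y_def)
  qed
  show ?thesis by (rule exI[of _ "30 * P\<^sup>2"]) (use main P(1) in auto)
qed

section \<open>The exceptional set\<close>

lemma summation_by_parts:
  fixes s a :: "nat \<Rightarrow> 'a::comm_ring"
  shows "(\<Sum>k<N. s k * a k) = (\<Sum>k<N. (\<Sum>j<Suc k. s j) * (a k - a (Suc k))) + (\<Sum>j<N. s j) * a N"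
  by (induction N) (auto simp: algebra_simps)

text \<open>Multiplication by \<open>cis x\<close> shifts the transform by 1. The vanishing factor
  therefore appears as the twisted first difference that summation by parts produces.\<close>

lemma fourier_vanishing_factor:
  assumes g: "test_fun U g"
  shows "fourier (\<lambda>x. (1 - cis (x - \<theta>)) * g x) t = fourier g t - cis (- \<theta>) * fourier g (t - 1)"
proof -
  have t: "test_fun U (\<lambda>x. - cis (- \<theta>) * (g x * cis (- (-1 * x))))"
    using test_fun_mult[OF test_fun_modulate[OF g, of "-1"] smooth_fun_const[of "- cis (- \<theta>)"]]
    by (simp add: mult.commute)
  have eq: "(\<lambda>x. (1 - cis (x - \<theta>)) * g x) =
      (\<lambda>x. g x + - cis (- \<theta>) * (g x * cis (- (-1 * x))))"
    by (simp add: fun_eq_iff algebra_simps cis_mult mult.left_commute[of _ "g _"])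
  show ?thesis unfolding eq fourier_add[OF g t] fourier_cmult fourier_modulate by simp
qed

context power_series_disc
begin

text \<open>The twist \<open>cis \<theta> ^ k\<close> is moved from the transform to the
  coefficients, so that summation by parts meets the partial sums at \<theta>, bounded by
  \<open>M\<close>. The differences of the twisted transforms are controlled by \<open>A\<close> and
  summed with \<open>sum_inverse_quadratic_le\<close>.\<close>

lemma norm_coeff_sum_le:
  assumes bdd: "\<And>k. norm (c k) \<le> C"
    and M: "\<And>N. norm (\<Sum>k<N. c k * cis \<theta> ^ k) \<le> M"
    and g: "test_fun U g"
    and \<delta>: "0 < \<delta>" "\<delta> \<le> 1" and "A \<ge> 0"
    and A: "\<And>t. norm (fourier (\<lambda>x. (1 - cis (x - \<theta>)) * g x) t) \<le> A / (1 + (\<delta> * t)\<^sup>2)"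
  shows "norm (\<Sum>k. c k * fourier g (real n - real k)) \<le> M * A * (3 * pi / \<delta>)"
proof -
  define s where "s k = c k * cis \<theta> ^ k" for k
  define a where "a k = cis (- \<theta>) ^ k * fourier g (real n - real k)" for k
  have M0: "M \<ge> 0" using M[of 0] by simp
  have C: "C \<ge> 0" using order_trans[OF norm_ge_zero bdd[of 0]] .
  have growth: "norm (c k) \<le> C * (1 + real k)" for k
    using order_trans[OF bdd[of k]] mult_left_mono[OF _ C, of 1 "1 + real k"] by simp
  have sa: "s k * a k = c k * fourier g (real n - real k)" for k
  proof -
    have "cis \<theta> ^ k * cis (- \<theta>) ^ k = 1"
      by (simp add: cis_mult flip: power_mult_distrib)
    moreover have "s k * a k = (cis \<theta> ^ k * cis (- \<theta>) ^ k) * (c k * fourier g (real n - real k))"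
      by (simp only: s_def a_def mult_ac)
    ultimately show ?thesis by simp
  qed
  have "norm (a k - a (Suc k)) \<le> A / (1 + (\<delta> * (real n - real k))\<^sup>2)" for k
  proof -
    have "a k - a (Suc k) = cis (- \<theta>) ^ k *
        fourier (\<lambda>x. (1 - cis (x - \<theta>)) * g x) (real n - real k)"
      unfolding fourier_vanishing_factor[OF g] by (simp add: a_def algebra_simps)
    then show ?thesis using A[of "real n - real k"] by (simp add: norm_mult norm_power)
  qed
  then have d: "norm ((\<Sum>j<Suc k. s j) * (a k - a (Suc k))) \<le> M * (A / (1 + (\<delta> * (real n - real k))\<^sup>2))" for k
    unfolding norm_mult s_def by (intro mult_mono M norm_ge_zero M0)
  have part: "norm (\<Sum>k<N. c k * fourier g (real n - real k)) \<le>
      M * A * (3 * pi / \<delta>) + M * norm (fourier g (real n - real N))" for N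
  proof -
    have "norm (\<Sum>k<N. (\<Sum>j<Suc k. s j) * (a k - a (Suc k))) \<le>
        (\<Sum>k<N. M * (A / (1 + (\<delta> * (real n - real k))\<^sup>2)))"
      by (intro sum_norm_le d)
    also have "\<dots> = M * A * (\<Sum>k<N. 1 / (1 + (\<delta> * (real n - real k))\<^sup>2))"
      by (simp add: sum_distrib_left)
    also have "\<dots> \<le> M * A * (3 * pi / \<delta>)"
      using M0 \<open>A \<ge> 0\<close> by (intro mult_left_mono sum_inverse_quadratic_le \<delta>) auto
    finally have "norm (\<Sum>k<N. (\<Sum>j<Suc k. s j) * (a k - a (Suc k))) \<le> M * A * (3 * pi / \<delta>)" .
    moreover have "norm ((\<Sum>j<N. s j) * a N) \<le> M * norm (fourier g (real n - real N))"
      using M[of N] by (simp add: norm_mult a_def norm_power s_def mult_right_mono)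
    ultimately show ?thesis
      unfolding sa[symmetric] summation_by_parts[of s a N]
      using norm_triangle_ineq[of "\<Sum>k<N. (\<Sum>j<Suc k. s j) * (a k - a (Suc k))" "(\<Sum>j<N. s j) * a N"]
      by linarith
  qed
  \<comment> \<open>Removes the boundary term of the summation by parts.\<close>
  have "(\<lambda>N. fourier g (real n - real N)) \<longlonglongrightarrow> 0"
  proof -
    obtain B where B: "\<And>t. norm (fourier g t) \<le> B / (1 + t\<^sup>2) ^ 1"
      using fourier_decay[OF g] by metis
    have "(\<lambda>N. B * (1 / (1 + (real n - real N)\<^sup>2))) \<longlonglongrightarrow> 0"
      by (intro tendsto_mult_right_zero summable_LIMSEQ_zero summable_inverse_quadratic)
    then show ?thesis
      by (rule Lim_null_comparison[rotated]) (use B in auto)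
  qed
  then have r: "(\<lambda>N. M * A * (3 * pi / \<delta>) + M * norm (fourier g (real n - real N))) \<longlonglongrightarrow>
      M * A * (3 * pi / \<delta>) + M * norm (0 :: complex)"
    by (intro tendsto_intros)
  have "(\<lambda>N. \<Sum>k<N. c k * fourier g (real n - real k)) \<longlonglongrightarrow> (\<Sum>k. c k * fourier g (real n - real k))"
    by (rule summable_LIMSEQ[OF summable_norm_cancel[OF summable_coeff_fourier[OF growth g]]])
  from LIMSEQ_le[OF tendsto_norm[OF this] r] part show ?thesis by auto
qed

lemma fourier_sum:
  assumes "finite I" "\<And>k. k \<in> I \<Longrightarrow> test_fun U (f k)"
  shows "fourier (\<lambda>x. \<Sum>k\<in>I. f k x) t = (\<Sum>k\<in>I. fourier (f k) t)"
  unfolding fourier_def sum_distrib_left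
  by (rule Bochner_Integration.integral_sum) (use fourier_integrable assms(2) in blast)

text \<open>The order of choices matters: \<epsilon> fixes \<eta>, then the neighbourhood
  \<open>W\<close> of the bad set, then \<delta>, and only then does \<open>n\<close> grow. The
  finitely many good pieces are null at a rate depending on \<delta>, whereas the bound for the bad
  ones is uniform in \<open>n\<close>.\<close>

lemma boundary_null_near_bounded_set:
  assumes bdd: "\<And>k. norm (c k) \<le> C"
    and B: "closed B" "B \<in> null_sets lborel"
    and M: "\<And>\<theta> N. \<theta> \<in> B \<inter> V \<Longrightarrow> norm (\<Sum>k<N. c k * cis \<theta> ^ k) \<le> M"
    and away: "\<And>g. test_fun (- B) g \<Longrightarrow> boundary_null H g"
    and f: "test_fun V f"
  shows "boundary_null H f"
proof -
  have C: "C \<ge> 0" using order_trans[OF norm_ge_zero bdd[of 0]] .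
  have growth: "norm (c k) \<le> C * (1 + real k)" for k
    using order_trans[OF bdd[of k]] mult_left_mono[OF _ C, of 1 "1 + real k"] by simp
  define S where "S g n = (\<Sum>k. c k * fourier g (real n - real k))" for g n
  have fU: "test_fun UNIV f" by (rule test_fun_UNIV[OF f])
  obtain K where K: "compact K" "K \<subseteq> V" "\<And>x. x \<notin> K \<Longrightarrow> f x = 0"
    using test_funE[OF f] by metis
  define L where "L = K \<inter> B"
  have L: "compact L" unfolding L_def using K(1) B(1) by (rule compact_Int_closed)
  have Lnull: "emeasure lborel L = 0"
  proof -
    have "emeasure lborel L \<le> emeasure lborel B"
      unfolding L_def using B(2) by (intro emeasure_mono) auto
    then show ?thesis using B(2) by auto
  qed
  obtain A where A: "A > 0"
    "\<And>\<delta> k \<theta> t. 0 < \<delta> \<Longrightarrow> \<delta> \<le> 1 \<Longrightarrow> \<theta> \<in> {\<delta> * (of_int k - 1)..\<delta> * (of_int k + 1)} \<Longrightarrow>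
      norm (fourier (\<lambda>x. (1 - cis (x - \<theta>)) * (f x * bump (x / \<delta> - of_int k))) t)
        \<le> A * \<delta>\<^sup>2 / (1 + (\<delta> * t)\<^sup>2)"
    using fourier_piece_bound[OF fU] by auto
  have "S f \<longlonglongrightarrow> 0"
    unfolding LIMSEQ_iff
  proof (intro allI impI)
    fix \<epsilon> :: real assume \<epsilon>: "\<epsilon> > 0"
    \<comment> \<open>\<open>M\<close> may be negative when \<open>B \<inter> V\<close> is empty;
      \<open>M'\<close> is positive in every case.\<close>
    define M' where "M' = \<bar>M\<bar> + 1"
    \<comment> \<open>Chosen so that all bad pieces together contribute at most
      \<epsilon>/2.\<close>
    define \<eta> where "\<eta> = \<epsilon> / (2 * (M' * A * (3 * pi)))"
    have M': "M' > 0" "M \<le> M'" by (auto simp: M'_def)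
    have \<eta>: "\<eta> > 0" using \<epsilon> M' A by (simp add: \<eta>_def)
    obtain W where W: "open W" "L \<subseteq> W" "emeasure lborel (W - L) < \<eta>"
      using outer_regular_lborel[OF borel_compact[OF L] \<eta>] by metis
    have Wm: "emeasure lborel W < \<eta>"
    proof -
      have LW: "L \<in> sets lborel" "W \<in> sets lborel"
        using W(1) L by (auto simp: borel_compact)
      have "emeasure lborel W = emeasure lborel (L \<union> (W - L))"
        using W(2) by (simp add: Un_absorb1)
      also have "\<dots> \<le> emeasure lborel L + emeasure lborel (W - L)"
        using LW by (intro emeasure_subadditive) auto
      finally show ?thesis using W(3) Lnull by simp
    qed
    obtain e where e: "e > 0" "\<And>x. x \<in> L \<Longrightarrow> ball x e \<subseteq> W"
      using Heine_Borel_lemma[OF L, of "{W}"] W by auto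
    \<comment> \<open>Points of \<open>J k\<close> and of the cell \<open>X k\<close> below are at
      distance at most 2\<delta> < e, so the cell of a bad index stays inside
      \<open>W\<close>.\<close>
    define \<delta> where "\<delta> = min 1 (e / 3)"
    have \<delta>: "0 < \<delta>" "\<delta> \<le> 1" "3 * \<delta> \<le> e" using e by (auto simp: \<delta>_def)
    define J where "J k = {\<delta> * (of_int k - 1)..\<delta> * (of_int k + 1)}" for k
    define p where "p k x = f x * bump (x / \<delta> - of_int k)" for k x
    obtain N where N: "f = (\<lambda>x. \<Sum>k\<in>{- int N..int N}. p k x)"
      unfolding p_def using test_fun_partition[OF f \<delta>(1)] by metis
    define I where "I = {- int N..int N}"
    define Ib where "Ib = {k \<in> I. J k \<inter> L \<noteq> {}}"
    have fin: "finite I" "finite Ib"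
      by (simp add: I_def) (rule finite_subset[of _ I], auto simp: Ib_def I_def)
    have tp: "test_fun V (p k)" for k
      unfolding p_def by (rule test_fun_piece_same[OF f])
    have Sf: "S f n = (\<Sum>k\<in>I - Ib. S (p k) n) + (\<Sum>k\<in>Ib. S (p k) n)" for n
    proof -
      have "S f n = (\<Sum>j. \<Sum>k\<in>I. c j * fourier (p k) (real n - real j))"
        unfolding S_def using fourier_sum[OF fin(1) tp] N by (simp add: I_def sum_distrib_left)
      also have "\<dots> = (\<Sum>k\<in>I. S (p k) n)"
        unfolding S_def
        by (rule suminf_sum) (rule summable_norm_cancel[OF summable_coeff_fourier[OF growth tp]])
      finally show ?thesis
        using sum.subset_diff[of Ib I "\<lambda>k. S (p k) n"] fin by (simp add: Ib_def)
    qed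
    have good: "S (p k) \<longlonglongrightarrow> 0" if "k \<in> I - Ib" for k
    proof -
      have KJ: "K \<inter> J k \<subseteq> - B" using that by (auto simp: Ib_def L_def)
      have "test_fun (- B) (p k)"
        unfolding p_def by (rule test_fun_piece[OF f \<delta>(1) K(1,3) KJ[unfolded J_def]])
      then show ?thesis
        using away boundary_null_iff[OF growth tp] unfolding S_def[abs_def] by blast
    qed
    have bad: "norm (S (p k) n) \<le> M' * A * (3 * pi) * \<delta>" if k: "k \<in> Ib" for k n
    proof -
      obtain \<theta> where \<theta>: "\<theta> \<in> J k" "\<theta> \<in> L" using k unfolding Ib_def by blast
      have "norm (S (p k) n) \<le> M' * (A * \<delta>\<^sup>2) * (3 * pi / \<delta>)"
        unfolding S_def
      proof (rule norm_coeff_sum_le[OF bdd _ tp \<delta>(1,2)])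
        have "\<theta> \<in> B \<inter> V" using \<theta>(2) K(2) by (auto simp: L_def)
        then show "norm (\<Sum>k<N. c k * cis \<theta> ^ k) \<le> M'" for N using M M'(2) order_trans by blast
        show "0 \<le> A * \<delta>\<^sup>2" using A by simp
        show "norm (fourier (\<lambda>x. (1 - cis (x - \<theta>)) * p k x) t) \<le> A * \<delta>\<^sup>2 / (1 + (\<delta> * t)\<^sup>2)" for t
          unfolding p_def using A(2)[OF \<delta>(1,2)] \<theta>(1) by (simp add: J_def)
      qed
      also have "\<dots> = M' * A * (3 * pi) * \<delta>" using \<delta> by (simp add: power2_eq_square)
      finally show ?thesis .
    qed
    have cnt: "real (card Ib) * \<delta> < \<eta>"
    proof -
      \<comment> \<open>The intervals \<open>J k\<close> overlap; the disjoint half-open cells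
        inside them allow the bad indices to be counted by measure.\<close>
      define X :: "int \<Rightarrow> real set" where "X k = {\<delta> * of_int k..<\<delta> * (of_int k + 1)}" for k
      have "(\<Sum>k\<in>Ib. emeasure lborel (X k)) = emeasure lborel (\<Union>k\<in>Ib. X k)"
      proof (rule sum_emeasure)
        show "disjoint_family_on X Ib"
          unfolding disjoint_family_on_def
        proof (intro ballI impI)
          fix k l :: int assume "k \<noteq> l"
          have False if "x \<in> X k" "x \<in> X l" for x
          proof -
            have "of_int k \<le> x / \<delta> \<and> x / \<delta> < of_int k + 1" "of_int l \<le> x / \<delta> \<and> x / \<delta> < of_int l + 1"
              using that \<delta> by (auto simp: X_def field_simps)
            then have "\<lfloor>x / \<delta>\<rfloor> = k" "\<lfloor>x / \<delta>\<rfloor> = l" by linarith+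
            then show False using \<open>k \<noteq> l\<close> by simp
          qed
          then show "X k \<inter> X l = {}" by blast
        qed
      qed (use fin in \<open>auto simp: X_def\<close>)
      also have "\<dots> \<le> emeasure lborel W"
      proof (rule emeasure_mono)
        show "(\<Union>k\<in>Ib. X k) \<subseteq> W"
        proof (intro UN_least subsetI)
          fix k x assume k: "k \<in> Ib" and x: "x \<in> X k"
          obtain \<theta> where \<theta>: "\<theta> \<in> J k" "\<theta> \<in> L" using k unfolding Ib_def by blast
          have "\<bar>\<theta> - x\<bar> < 3 * \<delta>"
            using \<theta>(1) x \<delta> by (auto simp: J_def X_def algebra_simps abs_if)
          then have "x \<in> ball \<theta> e" using \<delta>(3) by (simp add: dist_real_def)
          then show "x \<in> W" using e(2)[OF \<theta>(2)] by blast
        qed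
      qed (use W in simp)
      also have "\<dots> < ennreal \<eta>" by (rule Wm)
      also have "(\<Sum>k\<in>Ib. emeasure lborel (X k)) = (\<Sum>k\<in>Ib. ennreal \<delta>)"
        using \<delta> by (intro sum.cong) (simp_all add: X_def algebra_simps)
      also have "\<dots> = ennreal (\<Sum>k\<in>Ib. \<delta>)"
        using \<delta> by (intro sum_ennreal) simp
      finally show ?thesis using \<delta> by (simp add: ennreal_less_iff)
    qed
    have "(\<lambda>n. \<Sum>k\<in>I - Ib. S (p k) n) \<longlonglongrightarrow> (\<Sum>k\<in>I - Ib. 0)"
      by (intro tendsto_sum good)
    then obtain n0 where n0: "\<And>n. n \<ge> n0 \<Longrightarrow> norm (\<Sum>k\<in>I - Ib. S (p k) n) < \<epsilon> / 2"
      using \<epsilon> by (fastforce simp: LIMSEQ_iff dest: spec[of _ "\<epsilon> / 2"])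
    show "\<exists>no. \<forall>n\<ge>no. norm (S f n - 0) < \<epsilon>"
    proof (intro exI[of _ n0] allI impI)
      fix n assume "n \<ge> n0"
      have "norm (\<Sum>k\<in>Ib. S (p k) n) \<le> (\<Sum>k\<in>Ib. M' * A * (3 * pi) * \<delta>)"
        by (intro sum_norm_le bad)
      also have "\<dots> = (M' * A * (3 * pi)) * (real (card Ib) * \<delta>)" by simp
      also have "\<dots> \<le> (M' * A * (3 * pi)) * \<eta>"
        using cnt M' A by (intro mult_left_mono) auto
      also have "\<dots> = \<epsilon> / 2" using M' A by (simp add: \<eta>_def)
      finally show "norm (S f n - 0) < \<epsilon>"
        using n0[OF \<open>n \<ge> n0\<close>] norm_triangle_ineq[of "\<Sum>k\<in>I - Ib. S (p k) n" "\<Sum>k\<in>Ib. S (p k) n"]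
        unfolding Sf diff_0_right by linarith
    qed
  qed
  then show ?thesis
    using boundary_null_iff[OF growth f] by (simp add: S_def[abs_def])
qed

section \<open>The Baire category argument\<close>

theorem coeffs_tendsto_0_exceptional_set:
  assumes "closed E" "E \<subseteq> sphere 0 1" "{\<theta>. cis \<theta> \<in> E} \<in> null_sets lborel"
    and lpf: "lpf_boundary H {\<theta>. cis \<theta> \<notin> E}"
    and part: "\<And>w. w \<in> E \<Longrightarrow> Bseq (\<lambda>N. \<Sum>n\<le>N. c n * w ^ n)"
  shows "c \<longlonglongrightarrow> 0"
proof -
  have cont_cis: "continuous_on UNIV cis"
    using continuous_on_cis_mult[of UNIV 1] by simp
  have closed_E: "closed {\<theta>. cis \<theta> \<in> E}"
    using closed_vimage[OF assms(1) cont_cis] by (simp add: vimage_def)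
  \<comment> \<open>Passes from sums over \<open>n \<le> N\<close> to sums over
    \<open>k < N\<close>, and rounds the bound up to a natural number so that the sets
    \<open>BM M\<close> form a countable family.\<close>
  have part': "\<exists>M::nat. \<forall>N. norm (\<Sum>k<N. c k * w ^ k) \<le> real M" if w: "w \<in> E" for w
  proof -
    obtain D where D: "D > 0" "\<And>N. norm (\<Sum>n\<le>N. c n * w ^ n) \<le> D"
      using part[OF w] by (auto elim!: BseqE)
    obtain M where M: "D \<le> real M" using real_arch_simple by blast
    have "norm (\<Sum>k<N. c k * w ^ k) \<le> real M" for N
    proof (cases N)
      case (Suc m)
      then show ?thesis using D(2)[of m] M by (simp add: lessThan_Suc_atMost)
    qed simp
    then show ?thesis by blast
  qed
  \<comment> \<open>A bound on the coefficients must come first, since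
    \<open>boundary_null_iff\<close> relies on one. If \<open>E\<close> is empty, all test functions
    are already null; otherwise a single point of \<open>E\<close> bounds the differences of
    consecutive partial sums.\<close>
  have "\<exists>C. \<forall>k. norm (c k) \<le> C"
  proof (cases "E = {}")
    case True
    then have "c \<longlonglongrightarrow> 0"
      using lpf_boundary_imp_null[OF lpf] by (intro coeffs_tendsto_0) simp
    then have "Bseq c" by (intro convergent_imp_Bseq) (auto simp: convergent_def)
    then show ?thesis by (auto simp: Bseq_def)
  next
    case False
    then obtain w where w: "w \<in> E" by blast
    then have nw: "norm w = 1" using assms(2) by auto
    obtain M where M: "\<And>N. norm (\<Sum>k<N. c k * w ^ k) \<le> real M" using part'[OF w] by blast
    have "norm (c k) \<le> 2 * real M" for k
    proof -
      have eq: "c k * w ^ k = (\<Sum>j<Suc k. c j * w ^ j) - (\<Sum>j<k. c j * w ^ j)" by simp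
      have "norm (c k * w ^ k) \<le> real M + real M"
        unfolding eq
        using norm_triangle_ineq4[of "\<Sum>j<Suc k. c j * w ^ j" "\<Sum>j<k. c j * w ^ j"] M[of "Suc k"] M[of k]
        by linarith
      then show ?thesis by (simp add: norm_mult norm_power nw)
    qed
    then show ?thesis by blast
  qed
  then obtain C where C: "\<And>k. norm (c k) \<le> C" by blast
  define Gd where "Gd = {V. open V \<and> (\<forall>g. test_fun V g \<longrightarrow> boundary_null H g)}"
  define B where "B = - \<Union>Gd"
  have clB: "closed B" unfolding B_def Gd_def by (auto intro!: closed_Compl open_Union)
  have "{\<theta>. cis \<theta> \<notin> E} \<in> Gd"
    unfolding Gd_def using closed_E lpf_boundary_imp_null[OF lpf]
    by (auto simp: closed_def Compl_eq)
  then have BE: "B \<subseteq> {\<theta>. cis \<theta> \<in> E}" unfolding B_def by blast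
  have nullB: "B \<in> null_sets lborel"
    using null_sets_subset[OF assms(3) _ BE] clB by auto
  have away: "boundary_null H g" if "test_fun (- B) g" for g
    by (rule boundary_null_local[OF that]) (auto simp: B_def Gd_def)
  have "B = {}"
  proof (rule ccontr)
    assume "B \<noteq> {}"
    define BM where "BM M = B \<inter> {\<theta>. \<forall>N. norm (\<Sum>k<N. c k * cis \<theta> ^ k) \<le> real M}" for M :: nat
    have cl: "closed (BM M)" for M
      unfolding BM_def
      by (intro closed_Int clB closed_Collect_all closed_Collect_le continuous_intros cont_cis)
    have un: "B \<subseteq> (\<Union>M. BM M)"
      using BE part' by (fastforce simp: BM_def)
    \<comment> \<open>Some \<open>BM M\<close> has nonempty interior relative to \<open>B\<close>:
      otherwise the sets \<open>B - BM M\<close> would be relatively open and dense in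
      \<open>B\<close> with empty intersection.\<close>
    have "\<exists>M. \<not> B \<subseteq> closure (B - BM M)"
    proof (rule ccontr)
      assume "\<nexists>M. \<not> B \<subseteq> closure (B - BM M)"
      moreover have "openin (top_of_set B) (B - BM M)" for M
        by (rule openin_diff) (use cl in \<open>auto intro: closed_subset simp: BM_def\<close>)
      ultimately have "B \<subseteq> closure (\<Inter>(range (\<lambda>M. B - BM M)))"
        by (intro Baire[OF clB]) auto
      moreover have "\<Inter>(range (\<lambda>M. B - BM M)) = {}" using un by auto
      ultimately show False using \<open>B \<noteq> {}\<close> by (simp only: closure_empty subset_empty)
    qed
    then obtain M x where x: "x \<in> B" "x \<notin> closure (B - BM M)" by blast
    \<comment> \<open>Every point of \<open>B\<close> in \<open>V\<close> lies in
      \<open>BM M\<close>, which is the uniform bound required.\<close>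
    define V where "V = - closure (B - BM M)"
    have "boundary_null H g" if g: "test_fun V g" for g
    proof (rule boundary_null_near_bounded_set[OF C clB nullB _ away g])
      fix \<theta> N assume "\<theta> \<in> B \<inter> V"
      then have "\<theta> \<in> BM M" using closure_subset[of "B - BM M"] by (auto simp: V_def)
      then show "norm (\<Sum>k<N. c k * cis \<theta> ^ k) \<le> real M" by (auto simp: BM_def)
    qed
    then have "V \<in> Gd" by (auto simp: Gd_def V_def)
    then show False using x by (auto simp: B_def V_def)
  qed
  then show ?thesis using away by (intro coeffs_tendsto_0) simp
qed

end

section \<open>Null coefficient sequences give pseudofunctions\<close>

text \<open>A kernel whose Fourier transform is constant on \<open>[-a, a]\<close>: a difference of two Fejer
  kernels. The value of the constant is irrelevant; it is only known to be positive by scaling.\<close>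

lemma one_minus_cos_bounds:
  fixes y :: real
  shows "0 \<le> 1 - cos y" "1 - cos y \<le> 2" "1 - cos y \<le> y\<^sup>2 / 2"
proof -
  have "1 - cos y = 2 * (sin (y / 2))\<^sup>2" using cos_double_sin[of "y / 2"] by simp
  also have "\<dots> \<le> 2 * (y / 2)\<^sup>2"
    using abs_sin_x_le_abs_x[of "y / 2"] by (intro mult_left_mono abs_le_square_iff[THEN iffD1]) auto
  finally show "1 - cos y \<le> y\<^sup>2 / 2" by (simp add: power2_eq_square)
qed (use cos_ge_minus_one[of y] cos_le_one[of y] in linarith)+

text \<open>Joins the quadratic bound of the numerator near 0 with its bound 2 for large
  \<open>t\<close>. At \<open>t = 0\<close> the quotient is 0 by the convention for
  division.\<close>

lemma fejer_bound: "\<bar>(1 - cos (a * t)) / t\<^sup>2\<bar> \<le> (a\<^sup>2 / 2 + 2) * (1 / (1 + t\<^sup>2))" for a t :: real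
proof (cases "t = 0")
  case False
  have "(1 - cos (a * t)) * (1 + t\<^sup>2) = (1 - cos (a * t)) + (1 - cos (a * t)) * t\<^sup>2"
    by (simp add: algebra_simps)
  also have "\<dots> \<le> (a * t)\<^sup>2 / 2 + 2 * t\<^sup>2"
    using one_minus_cos_bounds[of "a * t"] by (intro add_mono mult_right_mono) auto
  also have "\<dots> = (a\<^sup>2 / 2 + 2) * t\<^sup>2" by (simp add: power_mult_distrib algebra_simps)
  finally show ?thesis
    using False one_minus_cos_bounds[of "a * t"]
    by (simp add: abs_of_nonneg pos_divide_le_eq pos_le_divide_eq add_pos_nonneg mult.commute)
qed simp

lemma fejer_integrable: "integrable lborel (\<lambda>t::real. (1 - cos (a * t)) / t\<^sup>2)"
  by (rule Bochner_Integration.integrable_bound[OF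
        integrable_mult_right[OF integrable_inverse_quadratic, of "a\<^sup>2 / 2 + 2"]])
    (use fejer_bound[of a] in \<open>auto intro: order_trans[OF _ abs_ge_self]\<close>)

definition fejer_const :: real where
  "fejer_const = (LINT t|lborel. (1 - cos t) / t\<^sup>2)"

lemma fejer_integral: "(LINT t|lborel. (1 - cos (a * t)) / t\<^sup>2) = \<bar>a\<bar> * fejer_const"
proof (cases "a = 0")
  case False
  have "(LINT t|lborel. (1 - cos (a * t)) / t\<^sup>2) =
      \<bar>1 / a\<bar> *\<^sub>R (LINT t|lborel. (1 - cos (a * (0 + 1 / a * t))) / (0 + 1 / a * t)\<^sup>2)"
    by (rule lborel_integral_real_affine) (use False in simp)
  also have "(\<lambda>t. (1 - cos (a * (0 + 1 / a * t))) / (0 + 1 / a * t)\<^sup>2) =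
      (\<lambda>t. a\<^sup>2 * ((1 - cos t) / t\<^sup>2))"
    using False by (auto simp: fun_eq_iff power_mult_distrib field_simps)
  also have "\<bar>1 / a\<bar> *\<^sub>R (LINT t|lborel. a\<^sup>2 * ((1 - cos t) / t\<^sup>2)) = \<bar>1 / a\<bar> * a\<^sup>2 * fejer_const"
    unfolding fejer_const_def by (subst integral_mult_right_zero) simp
  also have "\<bar>1 / a\<bar> * a\<^sup>2 = \<bar>a\<bar>" using False by (simp add: power2_eq_square abs_if)
  finally show ?thesis .
qed simp

lemma fejer_const_pos: "fejer_const > 0"
proof -
  \<comment> \<open>On [1, 2] the numerator is at least 1 - cos 1 and the denominator at most
    4.\<close>
  define d where "d = (1 - cos (1::real)) / 4"
  have "cos (1::real) < cos 0" using pi_gt3 by (intro cos_monotone_0_pi) auto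
  then have d: "d > 0" by (simp add: d_def)
  have "(LINT t|lborel. d * indicator {1..2::real} t) \<le> fejer_const"
    unfolding fejer_const_def
  proof (rule integral_mono)
    show "integrable lborel (\<lambda>t::real. (1 - cos t) / t\<^sup>2)" using fejer_integrable[of 1] by simp
    fix t :: real
    show "d * indicator {1..2} t \<le> (1 - cos t) / t\<^sup>2"
    proof (cases "t \<in> {1..2}")
      case True
      then have "cos t \<le> cos 1" using pi_gt3 by (intro cos_monotone_0_pi_le) auto
      moreover have "t\<^sup>2 \<le> 2\<^sup>2" using True by (intro power_mono) auto
      ultimately have "d \<le> (1 - cos t) / t\<^sup>2"
        unfolding d_def using True one_minus_cos_bounds(1)[of t] by (intro frac_le) auto
      then show ?thesis using True by simp
    qed (use one_minus_cos_bounds(1)[of t] in simp)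
  qed (auto intro!: integrable_mult_right integrable_real_indicator simp: emeasure_lborel_Icc_eq)
  then show ?thesis using d by simp
qed

text \<open>Up to a constant, (1 - cos(b t))/t^2 has as transform the tent of half-width b.
  Subtracting the tent of half-width \<open>a\<close> from that of half-width \<open>a + 1\<close>
  leaves a trapezoid with flat top [-a, a].\<close>

definition plateau_kernel :: "real \<Rightarrow> real \<Rightarrow> real" where
  "plateau_kernel a t = (1 - cos ((a + 1) * t)) / t\<^sup>2 - (1 - cos (a * t)) / t\<^sup>2"

lemma plateau_kernel_integrable: "integrable lborel (plateau_kernel a)"
  unfolding plateau_kernel_def[abs_def]
  by (intro Bochner_Integration.integrable_diff fejer_integrable)

lemma plateau_kernel_measurable [measurable]: "plateau_kernel a \<in> borel_measurable borel"
  unfolding plateau_kernel_def[abs_def] by measurable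

lemma plateau_kernel_bound:
  obtains D where "D > 0" "\<And>t. \<bar>plateau_kernel a t\<bar> \<le> D * (1 / (1 + t\<^sup>2))"
proof -
  define D where "D = ((a + 1)\<^sup>2 / 2 + 2) + (a\<^sup>2 / 2 + 2)"
  have "\<bar>plateau_kernel a t\<bar> \<le> D * (1 / (1 + t\<^sup>2))" for t
    using fejer_bound[of "a + 1" t] fejer_bound[of a t]
    unfolding plateau_kernel_def D_def distrib_right by linarith
  moreover have "D > 0" unfolding D_def using zero_le_power2[of a] zero_le_power2[of "a + 1"] by linarith
  ultimately show ?thesis using that by blast
qed

text \<open>The product formula for cosines reduces the cosine part to \<open>fejer_integral\<close>
  at b + x, b - x and x, where |b + x| + |b - x| = 2b once |x| \<le> b. The sine part vanishes by
  oddness.\<close>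

lemma plateau_kernel_transform:
  assumes "\<bar>x\<bar> \<le> a"
  shows "(LINT t|lborel. complex_of_real (plateau_kernel a t) * cis (t * x)) = of_real fejer_const"
proof -
  define f where "f b t = (1 - cos (b * t)) / t\<^sup>2" for b t :: real
  have f: "integrable lborel (f b)" "(LINT t|lborel. f b t) = \<bar>b\<bar> * fejer_const" for b
    unfolding f_def using fejer_integrable fejer_integral by auto
  have eq: "f b t * cos (t * x) = (f (b + x) t + f (b - x) t) / 2 - f x t" for b t
    unfolding f_def by (simp add: cos_add cos_diff ring_distribs diff_divide_distrib add_divide_distrib mult.commute)
  have F: "(LINT t|lborel. f b t * cos (t * x)) = ((\<bar>b + x\<bar> + \<bar>b - x\<bar>) / 2 - \<bar>x\<bar>) * fejer_const" for b
    unfolding eq using f by (simp add: algebra_simps)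
  have Fi: "integrable lborel (\<lambda>t. f b t * cos (t * x))" for b
    unfolding eq using f(1) by auto
  have "(LINT t|lborel. plateau_kernel a t * cos (t * x)) =
      (LINT t|lborel. f (a + 1) t * cos (t * x)) - (LINT t|lborel. f a t * cos (t * x))"
    unfolding plateau_kernel_def f_def[symmetric] left_diff_distrib
    by (rule Bochner_Integration.integral_diff[OF Fi Fi])
  also have "\<dots> = ((a + 1 - \<bar>x\<bar>) - (a - \<bar>x\<bar>)) * fejer_const"
  proof -
    have "\<bar>b + x\<bar> + \<bar>b - x\<bar> = 2 * b" if "\<bar>x\<bar> \<le> b" for b using that by linarith
    then show ?thesis using assms by (simp add: F left_diff_distrib) (simp add: field_simps)
  qed
  finally have C: "(LINT t|lborel. plateau_kernel a t * cos (t * x)) = fejer_const" by simp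
  have "(LINT t|lborel. plateau_kernel a t * sin (t * x)) =
      (LINT t|lborel. plateau_kernel a (0 + (-1) * t) * sin ((0 + (-1) * t) * x))"
    by (subst lborel_integral_real_affine[where c = "-1" and t = 0]) auto
  also have "\<dots> = - (LINT t|lborel. plateau_kernel a t * sin (t * x))"
    by (simp add: plateau_kernel_def)
  finally have S: "(LINT t|lborel. plateau_kernel a t * sin (t * x)) = 0" by simp
  have ints: "integrable lborel (\<lambda>t. plateau_kernel a t * cos (t * x))"
    "integrable lborel (\<lambda>t. plateau_kernel a t * sin (t * x))"
    by (rule Bochner_Integration.integrable_bound[OF plateau_kernel_integrable[of a]];
        auto simp: abs_mult mult_left_le)+
  have "(\<lambda>t. complex_of_real (plateau_kernel a t) * cis (t * x)) =
      (\<lambda>t. of_real (plateau_kernel a t * cos (t * x)) + \<i> * of_real (plateau_kernel a t * sin (t * x)))"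
    by (simp add: fun_eq_iff cis.code Complex_eq algebra_simps)
  then show ?thesis
    using ints by (simp add: C S del: of_real_mult)
qed

text \<open>By Fubini the transform of the kernel falls on \<open>f\<close>, on whose support it is
  constant. This turns the point evaluation of \<open>fourier f\<close> at an integer, as in the
  boundary series, into an integral against a decaying function.\<close>

lemma plateau_kernel_reproducing:
  assumes f: "test_fun {-a..a} f"
  shows "(LINT t|lborel. complex_of_real (plateau_kernel a (t - s)) * fourier f (- t)) =
    of_real fejer_const * fourier f (- s)"
proof -
  define K where "K t = complex_of_real (plateau_kernel a t)" for t
  have [measurable]: "K \<in> borel_measurable borel" unfolding K_def[abs_def] by measurable
  have [measurable]: "cis \<in> borel_measurable borel"
    using smooth_fun_measurable[OF smooth_fun_cis[of 1]] by simp
  have [measurable]: "f \<in> borel_measurable borel"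
    by (rule smooth_fun_measurable[OF test_fun_smooth[OF f]])
  have Ki: "integrable lborel (\<lambda>t. norm (K t))"
    using plateau_kernel_integrable[of a] by (simp add: K_def)
  have fi: "integrable lborel (\<lambda>x. norm (f x))"
    using test_fun_integrable'[OF f] by simp
  define h where "h t x = K t * (cis ((t + s) * x) * f x)" for t x
  have hi: "integrable (lborel \<Otimes>\<^sub>M lborel) (case_prod h)"
  proof (rule lborel_pair.Fubini_integrable)
    show "case_prod h \<in> borel_measurable (lborel \<Otimes>\<^sub>M lborel)"
      unfolding h_def[abs_def] by measurable
    show "integrable lborel (\<lambda>t. LINT x|lborel. norm (case_prod h (t, x)))"
      using Ki by (simp add: h_def norm_mult)
    show "AE t in lborel. integrable lborel (\<lambda>x. case_prod h (t, x))"
      using test_fun_integrable_cis[OF f] by (simp add: h_def)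
  qed
  have "(LINT t|lborel. K (t - s) * fourier f (- t)) = (LINT t|lborel. K t * fourier f (- (t + s)))"
    by (subst lborel_integral_real_affine[where c = 1 and t = s]) (auto simp: algebra_simps)
  also have "\<dots> = (LINT t|lborel. LINT x|lborel. h t x)"
    unfolding h_def fourier_def by (simp only: mult_minus_left minus_minus integral_mult_right_zero)
  also have "\<dots> = (LINT x|lborel. LINT t|lborel. h t x)"
    by (rule lborel_pair.Fubini_integral[OF hi, symmetric])
  also have "\<dots> = (LINT x|lborel. of_real fejer_const * (cis (- (- s * x)) * f x))"
  proof (rule Bochner_Integration.integral_cong[OF refl])
    fix x
    show "(LINT t|lborel. h t x) = of_real fejer_const * (cis (- (- s * x)) * f x)"
    proof (cases "\<bar>x\<bar> \<le> a")
      case True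
      have "h t x = (K t * cis (t * x)) * (cis (s * x) * f x)" for t
        by (simp add: h_def distrib_right mult.assoc flip: cis_mult)
      then show ?thesis using plateau_kernel_transform[OF True] by (simp add: K_def)
    next
      case False
      then have "f x = 0" using f by (elim test_funE) force
      then show ?thesis by (simp add: h_def)
    qed
  qed
  also have "\<dots> = of_real fejer_const * fourier f (- s)"
    unfolding fourier_def by simp
  finally show ?thesis by (simp add: K_def)
qed

text \<open>An inequality of Peetre's type, moving the shift into a constant factor.\<close>

lemma quadratic_shift_le: "1 / (1 + (t - s)\<^sup>2) \<le> 2 * (1 + s\<^sup>2) * (1 / (1 + t\<^sup>2))" for s t :: real
proof -
  have "0 \<le> (t - 2 * s)\<^sup>2" by simp
  then have "t\<^sup>2 \<le> 2 * s\<^sup>2 + 2 * (t - s)\<^sup>2" by (simp add: power2_eq_square algebra_simps)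
  moreover have "0 \<le> s\<^sup>2 * (t - s)\<^sup>2" by simp
  moreover have "2 * (1 + s\<^sup>2) * (1 + (t - s)\<^sup>2) = 2 + 2 * s\<^sup>2 + 2 * (t - s)\<^sup>2 + 2 * (s\<^sup>2 * (t - s)\<^sup>2)"
    by (simp add: ring_distribs)
  ultimately have "1 + t\<^sup>2 \<le> 2 * (1 + s\<^sup>2) * (1 + (t - s)\<^sup>2)"
    by linarith
  then show ?thesis by (simp add: pos_divide_le_eq pos_le_divide_eq add_pos_nonneg)
qed

lemma tendsto_inverse_quadratic_at_infinity: "((\<lambda>t::real. 1 / (1 + (t - s)\<^sup>2)) \<longlongrightarrow> 0) at_infinity"
proof (rule Lim_null_comparison)
  have "((\<lambda>t::real. 2 * (1 + s\<^sup>2) * \<bar>inverse t\<bar>) \<longlongrightarrow> 2 * (1 + s\<^sup>2) * \<bar>0\<bar>) at_infinity"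
    by (intro tendsto_intros tendsto_inverse_0)
  then show "((\<lambda>t::real. 2 * (1 + s\<^sup>2) * \<bar>inverse t\<bar>) \<longlongrightarrow> 0) at_infinity" by simp
  have "norm (1 / (1 + (t - s)\<^sup>2)) \<le> 2 * (1 + s\<^sup>2) * \<bar>inverse t\<bar>" if "t \<noteq> 0" for t :: real
  proof -
    have "0 \<le> (\<bar>t\<bar> - 1)\<^sup>2" by simp
    then have "\<bar>t\<bar> \<le> 1 + t\<^sup>2" by (simp add: power2_eq_square algebra_simps)
    then have "1 / (1 + t\<^sup>2) \<le> \<bar>inverse t\<bar>"
      using that by (simp add: pos_divide_le_eq add_pos_nonneg divide_inverse[symmetric] abs_inverse field_simps)
    then show ?thesis
      using order_trans[OF quadratic_shift_le[of t s]] mult_left_mono[of "1 / (1 + t\<^sup>2)" "\<bar>inverse t\<bar>" "2 * (1 + s\<^sup>2)"]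
      by (simp add: add_nonneg_nonneg)
  qed
  then show "\<forall>\<^sub>F t in at_infinity. norm (1 / (1 + (t - s)\<^sup>2)) \<le> 2 * (1 + s\<^sup>2) * \<bar>inverse t\<bar>"
    by (auto simp: eventually_at_infinity intro!: exI[of _ 1])
qed

section \<open>The boundary pseudofunction of a series with null coefficients\<close>

context power_series_disc
begin

lemma tendsto_0_growth:
  assumes "c \<longlonglongrightarrow> 0"
  obtains C where "C > 0" "\<And>k. norm (c k) \<le> C" "\<And>k. norm (c k) \<le> C * (1 + real k)"
proof -
  have "Bseq c" using assms by (intro convergent_imp_Bseq) (auto simp: convergent_def)
  then obtain C where C: "C > 0" "\<And>k. norm (c k) \<le> C" by (auto elim!: BseqE)
  have "norm (c k) \<le> C * (1 + real k)" for k
    using order_trans[OF C(2)[of k], of "C * (1 + real k)"] C(1) by simp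
  then show ?thesis using that C by blast
qed

text \<open>The limit is periodic and its Fourier transform a sum of point masses, so it is matched
  with a pseudofunction on bounded intervals. There the masses are smeared out: \<open>Q\<close> is
  the sum of the \<open>c k\<close> times plateau kernels centred at \<open>k\<close>, and
  \<open>plateau_kernel_reproducing\<close> shows that it acts in the same way.\<close>

lemma coeffs_tendsto_0_imp_lpf_boundary:
  assumes c0: "c \<longlonglongrightarrow> 0"
  shows "lpf_boundary H UNIV"
proof -
  obtain C where C: "C > 0" "\<And>k. norm (c k) \<le> C" "\<And>k. norm (c k) \<le> C * (1 + real k)"
    using tendsto_0_growth[OF c0] by metis
  define T where "T f = (\<Sum>k. c k * fourier f (- real k))" for f
  have lim: "((\<lambda>r. LINT \<theta>|lborel. H (complex_of_real r * cis \<theta>) * f \<theta>) \<longlongrightarrow> T f) (at_left 1)"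
    if "test_fun UNIV f" for f
    using radial_limit[OF C(3) that, of 0] by (simp add: T_def)
  have loc: "\<exists>V. open V \<and> x \<in> V \<and> V \<subseteq> UNIV \<and> pseudofun_on V T" for x
  proof -
    define a where "a = \<bar>x\<bar> + 1"
    obtain D where D: "D > 0" "\<And>t. \<bar>plateau_kernel a t\<bar> \<le> D * (1 / (1 + t\<^sup>2))"
      using plateau_kernel_bound by metis
    define q where "q k t = c k * complex_of_real (plateau_kernel a (t - real k))" for k t
    have qm [measurable]: "q k \<in> borel_measurable borel" for k
      unfolding q_def[abs_def] by measurable
    have qb: "norm (q k t) \<le> norm (c k) * (D * (1 / (1 + (t - real k)\<^sup>2)))" for k t
      using mult_left_mono[OF D(2)[of "t - real k"] norm_ge_zero[of "c k"]] by (simp add: q_def norm_mult)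
    have qb': "norm (q k t) \<le> C * D * (1 / (1 + (t - real k)\<^sup>2))" for k t
    proof -
      have "norm (c k) * (D * (1 / (1 + (t - real k)\<^sup>2))) \<le> C * (D * (1 / (1 + (t - real k)\<^sup>2)))"
        using C D by (intro mult_right_mono) auto
      then show ?thesis using qb[of k t] by simp
    qed
    have summ: "summable (\<lambda>k. norm (q k t))" for t
      by (rule summable_comparison_test'[OF summable_mult[OF summable_inverse_quadratic]]) (use qb' in simp)
    have part: "norm (\<Sum>k<N. q k t) \<le> C * D * (3 * pi)" for N t
    proof -
      have "norm (\<Sum>k<N. q k t) \<le> (\<Sum>k<N. C * D * (1 / (1 + (t - real k)\<^sup>2)))"
        by (intro sum_norm_le qb')
      also have "\<dots> = C * D * (\<Sum>k<N. 1 / (1 + (1 * (t - real k))\<^sup>2))"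
        by (simp add: sum_distrib_left)
      also have "\<dots> \<le> C * D * (3 * pi / 1)"
        using C D by (intro mult_left_mono sum_inverse_quadratic_le) auto
      finally show ?thesis by simp
    qed
    define Q where "Q t = (\<Sum>k. q k t)" for t
    have QN: "(\<lambda>N. \<Sum>k<N. q k t) \<longlonglongrightarrow> Q t" for t
      unfolding Q_def by (rule summable_LIMSEQ[OF summable_norm_cancel[OF summ]])
    have Qm [measurable]: "Q \<in> borel_measurable borel"
      by (rule borel_measurable_LIMSEQ_metric[OF _ QN]) measurable
    have Qb: "norm (Q t) \<le> C * D * (3 * pi)" for t
      by (rule LIMSEQ_le_const2[OF tendsto_norm[OF QN]]) (use part in auto)
    have Q0: "(Q \<longlongrightarrow> 0) at_infinity"
    proof (rule tendstoI)
      fix e :: real assume e: "e > 0"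
      \<comment> \<open>Makes the coefficients beyond \<open>K\<close> contribute at most
        \<open>e / 2\<close>, uniformly in \<open>t\<close>; the finitely many earlier terms each
        decay at infinity.\<close>
      define \<eta> where "\<eta> = e / (2 * (D * (3 * pi)))"
      have \<eta>: "\<eta> > 0" using e D by (simp add: \<eta>_def)
      obtain K where K: "\<And>k. k \<ge> K \<Longrightarrow> norm (c k) < \<eta>"
        using c0 \<eta> by (fastforce simp: LIMSEQ_iff)
      have ck: "norm (c k) \<le> \<eta> + (if k < K then C else 0)" for k
        using C(2)[of k] K[of k] \<eta> by (cases "k < K") auto
      have bound: "norm (Q t) \<le> e / 2 + (\<Sum>k<K. C * D * (1 / (1 + (t - real k)\<^sup>2)))" for t
      proof -
        define r where "r k = 1 / (1 + (t - real k)\<^sup>2)" for k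
        have r: "r k \<ge> 0" "summable r" "suminf r \<le> 3 * pi" for k
          using summable_inverse_quadratic[of t] suminf_inverse_quadratic_le[of t]
          unfolding r_def by (auto simp: add_nonneg_nonneg)
        have "norm (q k t) \<le> \<eta> * D * r k + (if k \<in> {..<K} then C * D * r k else 0)" for k
        proof -
          have "norm (q k t) \<le> (\<eta> + (if k < K then C else 0)) * (D * r k)"
            using order_trans[OF qb[of k t] mult_right_mono[OF ck[of k]]] r(1)[of k] D(1)
            unfolding r_def by simp
          then show ?thesis by (simp add: algebra_simps split: if_splits)
        qed
        moreover have "summable (\<lambda>k. \<eta> * D * r k)" by (intro summable_mult r)
        moreover have "summable (\<lambda>k. if k \<in> {..<K} then C * D * r k else 0)"
          by (rule summable_If_finite_set) simp
        ultimately have "norm (Q t) \<le> (\<Sum>k. \<eta> * D * r k + (if k \<in> {..<K} then C * D * r k else 0))"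
          unfolding Q_def by (intro norm_suminf_le summable_add)
        also have "\<dots> = (\<Sum>k. \<eta> * D * r k) + (\<Sum>k. if k \<in> {..<K} then C * D * r k else 0)"
          by (intro suminf_add[symmetric] summable_mult r summable_If_finite_set) simp
        also have "(\<Sum>k. if k \<in> {..<K} then C * D * r k else 0) = (\<Sum>k<K. C * D * r k)"
          by (rule sums_unique[symmetric]) (rule sums_If_finite_set, simp)
        also have "(\<Sum>k. \<eta> * D * r k) \<le> \<eta> * D * (3 * pi)"
          using r \<eta> D by (subst suminf_mult) auto
        also have "\<eta> * D * (3 * pi) = e / 2" using D e by (simp add: \<eta>_def)
        finally show ?thesis by (simp add: r_def)
      qed
      have "((\<lambda>t. \<Sum>k<K. C * D * (1 / (1 + (t - real k)\<^sup>2))) \<longlongrightarrow> (\<Sum>k<K. C * D * 0)) at_infinity"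
        by (intro tendsto_sum tendsto_mult tendsto_const tendsto_inverse_quadratic_at_infinity)
      then have "\<forall>\<^sub>F t in at_infinity. (\<Sum>k<K. C * D * (1 / (1 + (t - real k)\<^sup>2))) < e / 2"
        by (rule order_tendstoD) (use e in simp)
      then show "\<forall>\<^sub>F t in at_infinity. dist (Q t) 0 < e"
      proof eventually_elim
        case (elim t)
        then show ?case using bound[of t] by simp
      qed
    qed
    \<comment> \<open>The factor 2 pi undoes the division in \<open>pseudofun_on\<close>, and
      \<open>fejer_const\<close> is the height of the plateau.\<close>
    define \<gamma> where "\<gamma> = complex_of_real (2 * pi / fejer_const)"
    have "pseudofun_on {-a<..<a} T"
      unfolding pseudofun_on_def
    proof (intro exI[of _ "\<lambda>t. \<gamma> * Q t"] conjI allI impI)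
      show "(\<lambda>t. \<gamma> * Q t) \<in> borel_measurable borel" by measurable
      show "bounded (range (\<lambda>t. \<gamma> * Q t))"
        unfolding bounded_iff using Qb
        by (auto simp: norm_mult intro!: exI[of _ "norm \<gamma> * (C * D * (3 * pi))"] mult_left_mono)
      show "((\<lambda>t. \<gamma> * Q t) \<longlongrightarrow> 0) at_infinity" by (rule tendsto_mult_right_zero[OF Q0])
      fix f assume f: "test_fun {-a<..<a} f"
      have fa: "test_fun {-a..a} f" by (rule test_fun_mono[OF f]) auto
      have fi: "integrable lborel (\<lambda>t. fourier f (- t))"
        using lborel_integrable_real_affine[OF fourier_integrable_lborel[OF f], of "-1" 0] by simp
      have [measurable]: "(\<lambda>t. fourier f (- t)) \<in> borel_measurable borel" using fi by auto
      have int: "integrable lborel (\<lambda>t. q k t * fourier f (- t))" for k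
      proof (rule Bochner_Integration.integrable_bound[OF integrable_mult_right[OF integrable_norm[OF fi], of "C * D"]])
        have "norm (q k t) \<le> C * D" for t
        proof -
          have "C * D * (1 / (1 + (t - real k)\<^sup>2)) \<le> C * D * 1"
            using C D by (intro mult_left_mono) (auto simp: pos_divide_le_eq add_pos_nonneg)
          then show ?thesis using qb'[of k t] by linarith
        qed
        then show "AE t in lborel. norm (q k t * fourier f (- t)) \<le> norm (C * D * norm (fourier f (- t)))"
          using C D by (auto simp: norm_mult abs_mult intro!: mult_right_mono)
      qed measurable
      have "(\<lambda>N. LINT t|lborel. (\<Sum>k<N. q k t) * fourier f (- t)) \<longlonglongrightarrow>
          (LINT t|lborel. Q t * fourier f (- t))"
      proof (rule integral_dominated_convergence[where w = "\<lambda>t. C * D * (3 * pi) * norm (fourier f (- t))"])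
        show "integrable lborel (\<lambda>t. C * D * (3 * pi) * norm (fourier f (- t)))" using fi by auto
        show "AE t in lborel. (\<lambda>N. (\<Sum>k<N. q k t) * fourier f (- t)) \<longlonglongrightarrow> Q t * fourier f (- t)"
          by (intro AE_I2 tendsto_mult QN tendsto_const)
        show "AE t in lborel. norm ((\<Sum>k<N. q k t) * fourier f (- t)) \<le> C * D * (3 * pi) * norm (fourier f (- t))" for N
          using part by (auto simp: norm_mult intro!: mult_right_mono)
      qed measurable
      moreover have "(LINT t|lborel. (\<Sum>k<N. q k t) * fourier f (- t)) =
          of_real fejer_const * (\<Sum>k<N. c k * fourier f (- real k))" for N
      proof -
        have "(LINT t|lborel. (\<Sum>k<N. q k t) * fourier f (- t)) =
            (\<Sum>k<N. LINT t|lborel. q k t * fourier f (- t))"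
          unfolding sum_distrib_right by (rule Bochner_Integration.integral_sum) (rule int)
        also have "\<dots> = (\<Sum>k<N. c k * (of_real fejer_const * fourier f (- real k)))"
          unfolding q_def mult.assoc
          by (simp add: plateau_kernel_reproducing[OF fa])
        finally show ?thesis by (simp add: sum_distrib_left mult_ac)
      qed
      moreover have "(\<lambda>N. of_real fejer_const * (\<Sum>k<N. c k * fourier f (- real k))) \<longlonglongrightarrow>
          of_real fejer_const * T f"
        using summable_LIMSEQ[OF summable_norm_cancel[OF summable_coeff_fourier[OF C(3) f, of 0]]]
        unfolding T_def by (intro tendsto_mult_left) simp
      ultimately have "(LINT t|lborel. Q t * fourier f (- t)) = of_real fejer_const * T f"
        using LIMSEQ_unique by auto
      then have "(LINT t|lborel. \<gamma> * Q t * fourier f (- t)) = \<gamma> * (of_real fejer_const * T f)"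
        by (simp add: mult.assoc)
      then show "T f = (LINT t|lborel. \<gamma> * Q t * fourier f (- t)) / complex_of_real (2 * pi)"
        using fejer_const_pos by (simp add: \<gamma>_def)
    qed
    moreover have "x \<in> {-a<..<a}" by (auto simp: a_def)
    ultimately show ?thesis by (intro exI[of _ "{-a<..<a}"]) auto
  qed
  show ?thesis
    unfolding lpf_boundary_def local_pseudofun_def
    using lim loc by (intro exI[of _ T]) auto
qed

end

section \<open>Convergence at a boundary point\<close>

lemma test_fun_translate:
  assumes "test_fun V f" "\<And>x. x + a \<in> V \<Longrightarrow> x \<in> U"
  shows "test_fun U (\<lambda>x. f (x + a))"
proof -
  obtain K where K: "smooth_fun f" "compact K" "K \<subseteq> V" "\<And>x. x \<notin> K \<Longrightarrow> f x = 0"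
    using test_funE[OF assms(1)] by metis
  show ?thesis
  proof (rule test_funI)
    show "smooth_fun (\<lambda>x. f (x + a))" using smooth_fun_affine[OF K(1), of 1 a] by simp
    show "compact ((\<lambda>x. x - a) ` K)"
      by (intro compact_continuous_image continuous_intros K)
    show "(\<lambda>x. x - a) ` K \<subseteq> U" using K(3) assms(2) by auto
    show "f (x + a) = 0" if "x \<notin> (\<lambda>x. x - a) ` K" for x
      using that by (intro K(4)) force
  qed
qed

text \<open>On a support avoiding the zeros of \<open>cis x - w\<close>, this factor can be divided
  out smoothly. Multiplying it back is a shift by 1 in the transform minus multiplication by
  \<open>w\<close>.\<close>

lemma test_fun_divide_cis:
  assumes f: "test_fun {x. cis x \<noteq> w} f"
  obtains g where "test_fun {x. cis x \<noteq> w} g" "\<And>t. fourier f t = fourier g (t - 1) - w * fourier g t"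
proof -
  obtain K where K: "smooth_fun f" "compact K" "K \<subseteq> {x. cis x \<noteq> w}" "\<And>x. x \<notin> K \<Longrightarrow> f x = 0"
    using test_funE[OF f] by metis
  define g where "g x = f x / (cis x - w)" for x
  have "smooth_fun g"
    unfolding g_def[abs_def]
  proof (rule smooth_fun_divide[OF K(1)])
    show "smooth_fun (\<lambda>x. cis x - w)"
      using smooth_fun_diff[OF smooth_fun_cis[of 1] smooth_fun_const[of w]] by simp
    fix x assume "cis x - w = 0"
    then have "x \<in> - K" using K(3) by auto
    then show "\<forall>\<^sub>F y in nhds x. f y = 0"
      using K(2,4) compact_imp_closed[OF K(2)] by (auto simp: eventually_nhds intro!: exI[of _ "- K"])
  qed
  then have tg: "test_fun {x. cis x \<noteq> w} g"
    by (rule test_funI[OF _ K(2,3)]) (simp add: g_def K(4))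
  have tg': "test_fun {x. cis x \<noteq> w} (\<lambda>x. (- w) * g x)"
    using test_fun_mult[OF tg smooth_fun_const[of "- w"]] by (simp add: mult.commute)
  have eq: "f = (\<lambda>x. g x * cis (- (-1 * x)) + (- w) * g x)"
  proof
    fix x
    show "f x = g x * cis (- (-1 * x)) + (- w) * g x"
    proof (cases "cis x = w")
      case True
      then have "f x = 0" using K(3,4) by auto
      then show ?thesis by (simp add: g_def)
    next
      case False
      then have "f x = g x * (cis x - w)" by (simp add: g_def)
      then show ?thesis by (simp add: algebra_simps)
    qed
  qed
  have "fourier f t = fourier g (t - 1) - w * fourier g t" for t
  proof -
    have "fourier f t = fourier (\<lambda>x. g x * cis (- (-1 * x)) + (- w) * g x) t" using eq by simp
    also have "\<dots> = fourier g (t + -1) + (- w) * fourier g t"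
      unfolding fourier_add[OF test_fun_modulate[OF tg, of "-1"] tg'] fourier_modulate fourier_cmult ..
    finally show ?thesis by simp
  qed
  then show ?thesis using that tg by blast
qed

section \<open>Coefficients of the difference quotient\<close>

context power_series_disc
begin

text \<open>Only meant for \<open>|w| = 1\<close>, where these are the coefficients of \<open>(H z - L) / (z - w)\<close>.\<close>
definition quotient_coeff :: "complex \<Rightarrow> complex \<Rightarrow> nat \<Rightarrow> complex" where
  "quotient_coeff w L k = (L - (\<Sum>j<Suc k. c j * w ^ j)) / w ^ Suc k"

lemma norm_partial_sum_le:
  assumes "\<And>k. norm (c k) \<le> C" "norm w = 1"
  shows "norm (L - (\<Sum>j<N. c j * w ^ j)) \<le> norm L + C * real N"
proof -
  have "norm (\<Sum>j<N. c j * w ^ j) \<le> (\<Sum>j<N. C)"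
    using assms by (intro sum_norm_le) (simp add: norm_mult norm_power)
  then show ?thesis
    using norm_triangle_ineq4[of L "\<Sum>j<N. c j * w ^ j"] by (simp add: mult.commute)
qed

lemma norm_quotient_coeff_le:
  assumes "\<And>k. norm (c k) \<le> C" "norm w = 1"
  shows "norm (quotient_coeff w L k) \<le> (norm L + C) * (1 + real k)"
proof -
  have "norm (quotient_coeff w L k) \<le> norm L + C * real (Suc k)"
    unfolding quotient_coeff_def norm_divide norm_power assms(2)
    using norm_partial_sum_le[OF assms, of L "Suc k"] by simp
  also have "\<dots> \<le> (norm L + C) * (1 + real k)" by (simp add: algebra_simps)
  finally show ?thesis .
qed

text \<open>Multiplied by z - w, the partial sums of the quotient series telescope to those of
  \<open>H z - L\<close> plus a remainder \<open>R N\<close>. Since |w| = 1 this remainder is at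
  most (|L| + C N) |z|^N, which tends to 0.\<close>

lemma power_series_disc_quotient:
  assumes bdd: "\<And>k. norm (c k) \<le> C" and w: "norm w = 1"
  shows "power_series_disc (quotient_coeff w L) (\<lambda>z. (H z - L) / (z - w))"
proof
  fix z :: complex assume z: "norm z < 1"
  have w0: "w \<noteq> 0" using w by auto
  have zw: "z - w \<noteq> 0" using z w by auto
  define R where "R N = z ^ N * (L - (\<Sum>j<N. c j * w ^ j)) / w ^ N" for N
  have part: "(z - w) * (\<Sum>k<N. quotient_coeff w L k * z ^ k) = (\<Sum>k<N. c k * z ^ k) - L + R N" for N
  proof (induction N)
    case (Suc N)
    define S where "S = (\<Sum>j<N. c j * w ^ j)"
    have "(z - w) * (quotient_coeff w L N * z ^ N) = c N * z ^ N + R (Suc N) - R N"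
      using w0 by (simp add: quotient_coeff_def R_def S_def[symmetric] field_simps)
    then show ?case using Suc.IH by (simp add: distrib_left)
  qed (simp add: R_def)
  have "R \<longlonglongrightarrow> 0"
  proof (rule Lim_null_comparison)
    show "\<forall>\<^sub>F N in sequentially. norm (R N) \<le> norm L * norm z ^ N + C * (real N * norm z ^ N)"
    proof (rule always_eventually, rule allI)
      fix N
      have "norm (R N) = norm z ^ N * norm (L - (\<Sum>j<N. c j * w ^ j))"
        by (simp add: R_def norm_mult norm_divide norm_power w)
      also have "\<dots> \<le> norm z ^ N * (norm L + C * real N)"
        by (intro mult_left_mono norm_partial_sum_le bdd w) simp
      finally show "norm (R N) \<le> norm L * norm z ^ N + C * (real N * norm z ^ N)"
        by (simp add: algebra_simps)
    qed
    have "(\<lambda>N. norm L * norm z ^ N + C * (real N * norm z ^ N)) \<longlonglongrightarrow> norm L * 0 + C * 0"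
      using z by (intro tendsto_intros LIMSEQ_power_zero powser_times_n_limit_0) auto
    then show "(\<lambda>N. norm L * norm z ^ N + C * (real N * norm z ^ N)) \<longlonglongrightarrow> 0" by simp
  qed
  moreover have "(\<lambda>N. \<Sum>k<N. c k * z ^ k) \<longlonglongrightarrow> H z"
    using sums[OF z] by (simp add: sums_def)
  ultimately have "(\<lambda>N. ((\<Sum>k<N. c k * z ^ k) - L + R N) / (z - w)) \<longlonglongrightarrow> (H z - L + 0) / (z - w)"
    using zw by (intro tendsto_intros)
  moreover have "((\<Sum>k<N. c k * z ^ k) - L + R N) / (z - w) = (\<Sum>k<N. quotient_coeff w L k * z ^ k)" for N
    unfolding part[symmetric] using zw by simp
  ultimately show "(\<lambda>k. quotient_coeff w L k * z ^ k) sums ((H z - L) / (z - w))"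
    by (simp add: sums_def)
qed

text \<open>The factor cis x - w divided out of the test function passes to the series, where it
  cancels the denominator and leaves \<open>H - L\<close>. In coefficients this is a shift of index,
  with \<open>L\<close> affecting only the constant term.\<close>

lemma quotient_coeff_convolution:
  assumes bdd: "\<And>k. norm (c k) \<le> C" and w: "norm w = 1" and g: "test_fun U g"
    and fg: "\<And>t. fourier f t = fourier g (t - 1) - w * fourier g t"
  shows "(\<Sum>k. quotient_coeff w L k * fourier f (real n - real k)) =
    (\<Sum>k. c k * fourier g (real n - real k)) - L * fourier g (real n)"
proof -
  have w0: "w \<noteq> 0" using w by auto
  have C: "C \<ge> 0" using order_trans[OF norm_ge_zero bdd[of 0]] .
  have growth: "norm (c k) \<le> C * (1 + real k)" for k
    using order_trans[OF bdd[of k]] mult_left_mono[OF _ C, of 1 "1 + real k"] by simp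
  interpret G: power_series_disc "quotient_coeff w L" "\<lambda>z. (H z - L) / (z - w)"
    by (rule power_series_disc_quotient[OF bdd w])
  define A where "A k = quotient_coeff w L k * fourier g (real n - real (Suc k))" for k
  define B where "B k = w * (quotient_coeff w L k * fourier g (real n - real k))" for k
  define D where "D k = c k * fourier g (real n - real k)" for k
  have sD: "summable D"
    unfolding D_def by (rule summable_norm_cancel[OF summable_coeff_fourier[OF growth g]])
  have sB: "summable B"
    unfolding B_def
    by (intro summable_mult summable_norm_cancel[OF G.summable_coeff_fourier[OF norm_quotient_coeff_le[OF bdd w] g]])
  have AB: "A k = B (Suc k) + D (Suc k)" for k
  proof -
    have eq: "quotient_coeff w L k = w * quotient_coeff w L (Suc k) + c (Suc k)"
      using w0 by (simp add: quotient_coeff_def field_simps)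
    show ?thesis
      unfolding A_def B_def D_def eq by (simp only: distrib_right mult.assoc)
  qed
  have sB': "summable (\<lambda>k. B (Suc k))" and sD': "summable (\<lambda>k. D (Suc k))"
    using sB sD by (simp_all only: summable_Suc_iff)
  have sA: "summable A" unfolding AB[abs_def] by (intro summable_add sB' sD')
  have "suminf A = (suminf B - B 0) + (suminf D - D 0)"
    unfolding AB using suminf_add[OF sB' sD'] suminf_split_head[OF sB] suminf_split_head[OF sD] by simp
  \<comment> \<open>The head terms left by the shift, where
    \<open>w * quotient_coeff w L 0 = L - c 0\<close>.\<close>
  moreover have "B 0 + D 0 = L * fourier g (real n)"
    using w0 by (simp add: B_def D_def quotient_coeff_def field_simps)
  moreover have "(\<Sum>k. quotient_coeff w L k * fourier f (real n - real k)) = suminf A - suminf B"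
    using suminf_diff[OF sA sB] by (simp add: A_def B_def fg algebra_simps)
  ultimately have "(\<Sum>k. quotient_coeff w L k * fourier f (real n - real k)) =
      suminf D - L * fourier g (real n)"
    by algebra
  then show ?thesis by (simp add: D_def[abs_def])
qed

text \<open>Since |w| = 1, the coefficients of the quotient have the moduli of \<open>L\<close>
  minus the partial sums, so it suffices that they tend to 0. Nullness of test functions for the
  quotient comes from the hypothesis near \<theta>0 and from that for \<open>H\<close> where cis x
  differs from \<open>w\<close>.\<close>

theorem sums_at_boundary_point:
  assumes c0: "c \<longlonglongrightarrow> 0"
    and lpf: "lpf_boundary_at (\<lambda>z. (H z - L) / (z - cis \<theta>0)) \<theta>0"
  shows "(\<lambda>n. c n * cis \<theta>0 ^ n) sums L"
proof -
  define w where "w = cis \<theta>0"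
  have w: "norm w = 1" by (simp add: w_def)
  have w0: "w \<noteq> 0" using w by auto
  obtain C where C: "\<And>k. norm (c k) \<le> C" "\<And>k. norm (c k) \<le> C * (1 + real k)"
    using tendsto_0_growth[OF c0] by metis
  define G where "G z = (H z - L) / (z - w)" for z
  interpret G: power_series_disc "quotient_coeff w L" G
    unfolding G_def[abs_def] by (rule power_series_disc_quotient[OF C(1) w])
  obtain U where U: "open U" "\<theta>0 \<in> U" "lpf_boundary G U"
    using lpf unfolding lpf_boundary_at_def G_def[abs_def] w_def by blast
  have away: "boundary_null G f" if f: "test_fun {x. cis x \<noteq> w} f" for f
  proof -
    obtain g where g: "test_fun {x. cis x \<noteq> w} g" "\<And>t. fourier f t = fourier g (t - 1) - w * fourier g t"
      using test_fun_divide_cis[OF f] by metis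
    have "boundary_null H g"
      by (rule lpf_boundary_imp_null[OF coeffs_tendsto_0_imp_lpf_boundary[OF c0] test_fun_UNIV[OF g(1)]])
    then have 1: "(\<lambda>n. \<Sum>k. c k * fourier g (real n - real k)) \<longlonglongrightarrow> 0"
      using boundary_null_iff[OF C(2) g(1)] by simp
    have 2: "(\<lambda>n. fourier g (real n)) \<longlonglongrightarrow> 0"
    proof -
      obtain B where B: "\<And>t. norm (fourier g t) \<le> B / (1 + t\<^sup>2) ^ 1"
        using fourier_decay[OF g(1)] by metis
      have "(\<lambda>n. B * (1 / (1 + (0 - real n)\<^sup>2))) \<longlonglongrightarrow> 0"
        by (intro tendsto_mult_right_zero summable_LIMSEQ_zero summable_inverse_quadratic)
      then show ?thesis by (rule Lim_null_comparison[rotated]) (use B in auto)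
    qed
    have "(\<lambda>n. (\<Sum>k. c k * fourier g (real n - real k)) - L * fourier g (real n)) \<longlonglongrightarrow> 0 - L * 0"
      by (intro tendsto_intros 1 2)
    then show ?thesis
      unfolding G.boundary_null_iff[OF norm_quotient_coeff_le[OF C(1) w] f]
        quotient_coeff_convolution[OF C(1) w g] by simp
  qed
  have "boundary_null G f" if "test_fun UNIV f" for f
  proof (rule G.boundary_null_local[OF that])
    fix x :: real
    show "\<exists>V. open V \<and> x \<in> V \<and> (\<forall>g. test_fun V g \<longrightarrow> boundary_null G g)"
    proof (cases "cis x = w")
      case False
      have "continuous_on UNIV cis" using continuous_on_cis_mult[of UNIV 1] by simp
      then have "open {x. cis x \<noteq> w}"
        by (intro open_Collect_neq continuous_on_const)
      then show ?thesis using False away by blast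
    next
      \<comment> \<open>The hypothesis speaks only of a neighbourhood of \<theta>0; the other
        preimages of \<open>w\<close> on the line are reached by translating by a multiple of the
        period.\<close>
      case True
      then have "sin x = sin \<theta>0 \<and> cos x = cos \<theta>0" by (simp add: w_def cis.code complex_eq_iff)
      then obtain j :: int where x: "x = \<theta>0 + 2 * pi * j"
        unfolding sin_cos_eq_iff by blast
      define V where "V = (\<lambda>y. y - 2 * pi * of_int j) -` U"
      have "open V" unfolding V_def using U(1) by (intro open_vimage continuous_intros)
      moreover have "x \<in> V" using U(2) x by (auto simp: V_def)
      moreover have "boundary_null G g" if "test_fun V g" for g
      proof (rule boundary_null_translate[of _ _ j])
        have "test_fun U (\<lambda>x. g (x + 2 * pi * of_int j))"
          by (rule test_fun_translate[OF that]) (auto simp: V_def)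
        then show "boundary_null G (\<lambda>x. g (x + 2 * pi * of_int j))"
          by (rule G.lpf_boundary_imp_null[OF U(3)])
      qed
      ultimately show ?thesis by blast
    qed
  qed
  then have "quotient_coeff w L \<longlonglongrightarrow> 0" by (rule G.coeffs_tendsto_0)
  then have "(\<lambda>k. L - (\<Sum>j<Suc k. c j * w ^ j)) \<longlonglongrightarrow> 0"
    by (rule Lim_null_comparison[rotated, OF tendsto_norm_zero])
      (simp add: quotient_coeff_def norm_divide norm_power norm_mult w)
  then have "(\<lambda>k. L - (L - (\<Sum>j<Suc k. c j * w ^ j))) \<longlonglongrightarrow> L - 0"
    by (intro tendsto_intros)
  then have "(\<lambda>k. \<Sum>j<Suc k. c j * w ^ j) \<longlonglongrightarrow> L" by simp
  then have "(\<lambda>k. \<Sum>j<k. c j * w ^ j) \<longlonglongrightarrow> L" by (rule LIMSEQ_imp_Suc)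
  then show ?thesis by (simp add: sums_def w_def)
qed

end

section \<open>Conclusion for a series with an exceptional set of measure zero\<close>

theorem theorem6p4:
  fixes c :: "nat \<Rightarrow> complex" and F :: "complex \<Rightarrow> complex" and E :: "complex set"
  assumes "\<forall>z. norm z < 1 \<longrightarrow> (\<lambda>n. c n * z ^ n) sums F z"
    and "closed E" and "E \<subseteq> sphere 0 1"
    and "{\<theta>. cis \<theta> \<in> E} \<in> null_sets lborel"
    and "lpf_boundary F {\<theta>. cis \<theta> \<notin> E}"
    and "\<forall>w\<in>E. Bseq (\<lambda>N. \<Sum>n\<le>N. c n * w ^ n)"
  shows "lpf_boundary F UNIV \<and> c \<longlonglongrightarrow> 0 \<and>
    (\<forall>\<theta>0 L. lpf_boundary_at (\<lambda>z. (F z - L) / (z - cis \<theta>0)) \<theta>0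
        \<longrightarrow> (\<lambda>n. c n * cis \<theta>0 ^ n) sums L)"
proof -
  interpret power_series_disc c F
    by unfold_locales (use assms(1) in blast)
  have "c \<longlonglongrightarrow> 0"
    using assms(6) by (intro coeffs_tendsto_0_exceptional_set[OF assms(2-5)]) blast
  then show ?thesis
    using coeffs_tendsto_0_imp_lpf_boundary sums_at_boundary_point by blast
qed

end
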